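(* Let $n\ge2$, $d\ge1$ and $\mathbf k=(k_1,\dots,k_d)\in[n-1]^d$. If $(N_1|t_1,\dots,N_d|t_d)\in\mathbb U_{\mathbf k}$, then $$\pi^{k_1}_{t_1}\big(g(N_1|t_1)g(N_2|t_2)\cdots g(N_d|t_d)\big)=N_1|t_1.$$ In other words, the first $k_1$ columns of the matrix $\big(g(N_1|t_1)\cdots g(N_d|t_d)\big)\big|_{\lambda=(-1)^{k_1-1}t_1}$ span the subspace $N_1$.
   Context: Notation. Fix $n\ge2$; $[m]=\{1,\dots,m\}$, $[i,j]=\{m\in\mathbb Z: i\le m\le j\}$. For $k\in[n-1]$, $\mathbb X_k=\mathrm{Gr}(k,n)\times\mathbb C^\times$, with points written $N|t$. A subspace $N\in\mathrm{Gr}(k,n)$ is the column span of a full-rank $n\times k$ matrix, and $P_J(N)$ is the maximal minor of that matrix with row set $J$ (rows in increasing order), defined up to a common nonzero scalar. Index sets of integers are reduced modulo $n$ to subsets of $[n]$, and $P_I:=0$ if the reduced set does not have exactly $k$ elements. $\lambda$ is an indeterminate. For $N|t\in\mathbb X_k$, $g(N|t)\in\mathrm{GL}_n(\mathbb C(\lambda))$ is the matrix with entries $g(N|t)_{ij}=c_{ij}\,P_{[j-k+1,j-1]\cup\{i\}}(N)/P_{[j-k,j-1]}(N)$, where $c_{ij}=1$ if $j\le k$; $c_{ij}=t$ if $j>k$ and $i\ge j$; $c_{ij}=\lambda$ if $j>k$ and $i<j$ (defined when the denominators are nonzero). For $z\in\mathbb C^\times$ and an $n\times n$ matrix $A$ over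 $\mathbb C[\lambda,\lambda^{-1}]$, $\pi^k_z(A)=N|z$ where $N$ is the span of the first $k$ columns of $A|_{\lambda=(-1)^{k-1}z}$ (defined when these columns are linearly independent). A point $N|t\in\mathbb X_k$ is positive if $t>0$ and $P_J(N)>0$ for all $k$-subsets $J$ of $[n]$ (for a suitable common rescaling of the Plücker coordinates). $\mathbb U_{\mathbf k}\subset\mathbb X_{k_1}\times\cdots\times\mathbb X_{k_d}$ is the set of $(N_1|t_1,\dots,N_d|t_d)$ such that each $N_i|t_i$ is positive and the $t_i$ are distinct. *)

theory Defs
  imports
    "HOL-Library.Complex_Order"
    "HOL-Computational_Algebra.Field_as_Ring"
    "HOL-Computational_Algebra.Polynomial_Factorial"
    "Jordan_Normal_Form.DL_Rank"
    "Jordan_Normal_Form.DL_Submatrix"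
    "Jordan_Normal_Form.Determinant"
begin

section \<open>Grassmannians and Pluecker coordinates\<close>

abbreviation column_span :: "nat \<Rightarrow> complex mat \<Rightarrow> complex vec set" where
  "column_span n A \<equiv> vec_space.col_space n A"

definition spanning_matrix :: "nat \<Rightarrow> nat \<Rightarrow> complex vec set \<Rightarrow> complex mat \<Rightarrow> bool" where
  "spanning_matrix n k N A \<longleftrightarrow>
     A \<in> carrier_mat n k \<and> vec_space.rank n A = k \<and> column_span n A = N"

definition Gr :: "nat \<Rightarrow> nat \<Rightarrow> complex vec set set" where
  "Gr k n = {N. \<exists>A. spanning_matrix n k N A}"

text \<open>Index sets consist of integers and follow the 1-based convention, whereas the rows of a
  matrix are numbered from 0: the integer \<open>m\<close> denotes row \<open>(m - 1) mod n\<close>.\<close>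

definition reduced_rows :: "nat \<Rightarrow> int set \<Rightarrow> nat set" where
  "reduced_rows n I = (\<lambda>m. nat ((m - 1) mod int n)) ` I"

definition row_minor :: "nat \<Rightarrow> nat \<Rightarrow> complex mat \<Rightarrow> int set \<Rightarrow> complex" where
  "row_minor n k A I =
     (if card (reduced_rows n I) = k then det (submatrix A (reduced_rows n I) UNIV) else 0)"

text \<open>The common scalar in the Pluecker coordinates of \<open>N\<close> is fixed by choosing one spanning
  matrix for each \<open>N\<close>; lemma \<open>plucker_unique\<close> below shows that another choice only rescales
  all coordinates simultaneously.\<close>

definition plucker :: "nat \<Rightarrow> nat \<Rightarrow> complex vec set \<Rightarrow> int set \<Rightarrow> complex" where
  "plucker n k N I = row_minor n k (SOME A. spanning_matrix n k N A) I"

text \<open>A point \<open>N|t\<close> is the pair \<open>(N, t)\<close>.\<close>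

type_synonym point = "complex vec set \<times> complex"

definition XX :: "nat \<Rightarrow> nat \<Rightarrow> point set" where
  "XX n k = Gr k n \<times> (UNIV - {0})"

text \<open>For complex numbers \<open>0 < z\<close> means that \<open>z\<close> is real and positive.\<close>

definition positive_point :: "nat \<Rightarrow> nat \<Rightarrow> point \<Rightarrow> bool" where
  "positive_point n k p \<longleftrightarrow> (case p of (N, t) \<Rightarrow>
     0 < t \<and>
     (\<exists>c. c \<noteq> 0 \<and> (\<forall>J. J \<subseteq> {1..int n} \<and> card J = k \<longrightarrow> 0 < c * plucker n k N J)))"

definition UU :: "nat \<Rightarrow> nat list \<Rightarrow> point list set" where
  "UU n ks = {ps. length ps = length ks \<and>
     (\<forall>i<length ks. ps ! i \<in> XX n (ks ! i) \<and> positive_point n (ks ! i) (ps ! i)) \<and>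
     distinct (map snd ps)}"

section \<open>The matrices \<open>g(N|t)\<close> over \<open>\<complex>(\<lambda>)\<close>\<close>

type_synonym ratfun = "complex poly fract"

definition const_rf :: "complex \<Rightarrow> ratfun" where
  "const_rf a = to_fract [:a:]"

definition lambda_rf :: ratfun where
  "lambda_rf = to_fract [:0, 1:]"

definition g_coeff :: "nat \<Rightarrow> complex \<Rightarrow> int \<Rightarrow> int \<Rightarrow> ratfun" where
  "g_coeff k t i j = (if j \<le> int k then 1 else if i \<ge> j then const_rf t else lambda_rf)"

text \<open>For a positive point none of the denominators vanishes; see \<open>plucker_positive_nonzero\<close>.\<close>

definition g_entry :: "nat \<Rightarrow> nat \<Rightarrow> point \<Rightarrow> int \<Rightarrow> int \<Rightarrow> ratfun" where
  "g_entry n k p i j = (case p of (N, t) \<Rightarrow>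
     g_coeff k t i j *
     const_rf (plucker n k N ({j - int k + 1..j - 1} \<union> {i}) / plucker n k N {j - int k..j - 1}))"

definition g_mat :: "nat \<Rightarrow> nat \<Rightarrow> point \<Rightarrow> ratfun mat" where
  "g_mat n k p = mat n n (\<lambda>(a, b). g_entry n k p (int a + 1) (int b + 1))"

definition g_product :: "nat \<Rightarrow> nat list \<Rightarrow> point list \<Rightarrow> ratfun mat" where
  "g_product n ks ps = foldr (*) (map2 (g_mat n) ks ps) (1\<^sub>m n)"

section \<open>Evaluation and the projections \<open>\<pi>\<close>\<close>

text \<open>The ring of Laurent polynomials \<open>\<complex>[\<lambda>, \<lambda>\<^sup>-\<^sup>1]\<close> as a subring of \<open>\<complex>(\<lambda>)\<close>.\<close>

definition laurent_polys :: "ratfun set" where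
  "laurent_polys = {to_fract p / lambda_rf ^ m |p m. True}"

text \<open>The value of a rational function, computed from its reduced fraction
  (and 0 at a pole).\<close>

definition eval_rf :: "complex \<Rightarrow> ratfun \<Rightarrow> complex" where
  "eval_rf x f = (case quot_of_fract f of (p, q) \<Rightarrow> poly p x / poly q x)"

definition eval_mat :: "complex \<Rightarrow> ratfun mat \<Rightarrow> complex mat" where
  "eval_mat x A = map_mat (eval_rf x) A"

definition first_cols :: "nat \<Rightarrow> 'a mat \<Rightarrow> 'a mat" where
  "first_cols k A = mat (dim_row A) k (\<lambda>(i, j). A $$ (i, j))"

text \<open>\<open>None\<close> means that \<open>\<pi>\<^sup>k\<^sub>z\<close> is not defined at \<open>A\<close>.\<close>

definition pi_proj :: "nat \<Rightarrow> nat \<Rightarrow> complex \<Rightarrow> ratfun mat \<Rightarrow> point option" where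
  "pi_proj n k z A =
     (let B = first_cols k (eval_mat ((-1) ^ (k - 1) * z) A)
      in if z \<noteq> 0 \<and> A \<in> carrier_mat n n \<and> elements_mat A \<subseteq> laurent_polys
            \<and> vec_space.rank n B = k
         then Some (column_span n B, z) else None)"

section \<open>Well-definedness\<close>

lemma eval_rf_Fract:
  assumes "poly q x \<noteq> 0"
  shows "eval_rf x (Fract p q) = poly p x / poly q x"
proof -
  have q0: "q \<noteq> 0" using assms by auto
  obtain d where d: "p = fst (normalize_quot (p, q)) * d" "q = snd (normalize_quot (p, q)) * d"
    using normalize_quotE[OF q0] by metis
  have "quot_of_fract (Fract p q) = normalize_quot (p, q)"
    using quot_of_fract_quot_to_fract[of "(p, q)"] by (simp add: quot_to_fract_def)
  moreover have "poly p x = poly (fst (normalize_quot (p, q))) x * poly d x"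
    using arg_cong[OF d(1), of "\<lambda>r. poly r x"] by (simp only: poly_mult)
  moreover have "poly q x = poly (snd (normalize_quot (p, q))) x * poly d x"
    using arg_cong[OF d(2), of "\<lambda>r. poly r x"] by (simp only: poly_mult)
  ultimately show ?thesis
    using assms by (simp only: eval_rf_def case_prod_unfold) auto
qed

lemma column_span_factor:
  assumes A: "A \<in> carrier_mat n k" and B: "B \<in> carrier_mat n k"
    and sub: "column_span n A \<subseteq> column_span n B"
  obtains M where "M \<in> carrier_mat k k" "A = B * M"
proof -
  interpret vec_space "TYPE(complex)" n .
  have "\<exists>x\<in>carrier_vec k. B *\<^sub>v x = col A j" if "j < k" for j
  proof -
    have "A *\<^sub>v unit_vec k j = col A j"
      using A that by (intro eq_vecI) auto
    then have "col A j \<in> column_span n A"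
      using A that unfolding col_space_eq[OF A] by (auto intro!: bexI[of _ "unit_vec k j"])
    then show ?thesis using sub B unfolding col_space_eq[OF B] by auto
  qed
  then obtain X where X: "\<And>j. j < k \<Longrightarrow> X j \<in> carrier_vec k \<and> B *\<^sub>v X j = col A j" by metis
  define M where "M = mat k k (\<lambda>(i, j). X j $ i)"
  have M: "M \<in> carrier_mat k k" by (simp add: M_def)
  have colM: "col M j = X j" if "j < k" for j
    using X[OF that] that by (intro eq_vecI) (auto simp: M_def)
  have "A = B * M"
  proof (rule eq_matI)
    fix i j assume "i < dim_row (B * M)" "j < dim_col (B * M)"
    then have i: "i < n" and j: "j < k" using B M by auto
    have "(B * M) $$ (i, j) = (B *\<^sub>v X j) $ i"
      using B M i j colM[OF j] by simp
    also have "\<dots> = A $$ (i, j)" using X[OF j] A i j by simp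
    finally show "A $$ (i, j) = (B * M) $$ (i, j)" by simp
  qed (use A B M in auto)
  then show ?thesis using M that by blast
qed

lemma reduced_rows_less:
  assumes "0 < n" "a \<in> reduced_rows n I"
  shows "a < n"
  using assms by (auto simp: reduced_rows_def nat_less_iff)

lemma row_minor_mult:
  assumes n: "0 < n" and B: "B \<in> carrier_mat n k" and M: "M \<in> carrier_mat k k"
  shows "row_minor n k (B * M) I = row_minor n k B I * det M"
proof (cases "card (reduced_rows n I) = k")
  case True
  let ?J = "reduced_rows n I"
  have lt: "a < n" if "a \<in> reduced_rows n I" for a
    using reduced_rows_less[OF n that] .
  then have J: "{i. i < n \<and> i \<in> ?J} = ?J" by auto
  have sub: "submatrix C ?J UNIV = mat k k (\<lambda>(i, j). C $$ (pick ?J i, j))"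
    if "C \<in> carrier_mat n k" for C :: "complex mat"
    using that True J by (auto simp: submatrix_def pick_UNIV intro!: cong_mat)
  have pk: "pick ?J i < n" if "i < k" for i
    using lt pick_in_set_le[of i ?J] that True by auto
  have "submatrix (B * M) ?J UNIV = submatrix B ?J UNIV * M"
    unfolding sub[OF B] sub[OF mult_carrier_mat[OF B M]]
    by (rule eq_matI) (use B M pk in \<open>auto simp: scalar_prod_def\<close>)
  moreover have "submatrix B ?J UNIV \<in> carrier_mat k k" by (simp add: sub[OF B])
  ultimately show ?thesis using True M by (simp add: row_minor_def det_mult)
qed (simp add: row_minor_def)

lemma plucker_unique:
  assumes n: "0 < n" and A: "spanning_matrix n k N A"
  shows "\<exists>c. c \<noteq> 0 \<and> (\<forall>I. plucker n k N I = c * row_minor n k A I)"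
proof -
  define B where "B = (SOME A. spanning_matrix n k N A)"
  have B: "spanning_matrix n k N B" unfolding B_def using A by (rule someI)
  obtain M where M: "M \<in> carrier_mat k k" "B = A * M"
    using A B column_span_factor[of B n k A] by (auto simp: spanning_matrix_def)
  obtain L where L: "L \<in> carrier_mat k k" "A = B * L"
    using A B column_span_factor[of A n k B] by (auto simp: spanning_matrix_def)
  have 1: "row_minor n k B I = row_minor n k A I * det M" for I
    using row_minor_mult[OF n _ M(1)] A M(2) by (auto simp: spanning_matrix_def)
  have 2: "row_minor n k A I = row_minor n k B I * det L" for I
    using row_minor_mult[OF n _ L(1)] B L(2) by (auto simp: spanning_matrix_def)
  show ?thesis
  proof (cases "det M = 0")
    case True
    then have "row_minor n k B I = 1 * row_minor n k A I" for I using 1[of I] 2[of I] by simp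
    then show ?thesis unfolding plucker_def B_def[symmetric] by (intro exI[of _ 1]) simp
  next
    case False
    then show ?thesis unfolding plucker_def B_def[symmetric]
      using 1 by (intro exI[of _ "det M"]) (simp add: mult.commute)
  qed
qed

lemma plucker_positive_nonzero:
  assumes n: "0 < n" and p: "positive_point n k (N, t)" and I: "card (reduced_rows n I) = k"
  shows "plucker n k N I \<noteq> 0"
proof -
  let ?J = "(\<lambda>a. int a + 1) ` reduced_rows n I"
  have lt: "a < n" if "a \<in> reduced_rows n I" for a
    using reduced_rows_less[OF n that] .
  have "?J \<subseteq> {1..int n}" using lt by force
  moreover have "card ?J = k" using I by (subst card_image) (auto simp: inj_on_def)
  moreover obtain c where "\<And>J. J \<subseteq> {1..int n} \<Longrightarrow> card J = k \<Longrightarrow> 0 < c * plucker n k N J"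
    using p unfolding positive_point_def by blast
  ultimately have "0 < c * plucker n k N ?J" by blast
  then have "plucker n k N ?J \<noteq> 0" by auto
  moreover have "reduced_rows n ?J = reduced_rows n I"
  proof -
    have "reduced_rows n ?J = (\<lambda>a. nat (int a mod int n)) ` reduced_rows n I"
      unfolding reduced_rows_def[of n ?J] image_image by simp
    also have "\<dots> = (\<lambda>a. a) ` reduced_rows n I"
      by (rule image_cong) (use lt in auto)
    finally show ?thesis by simp
  qed
  ultimately show ?thesis by (simp only: plucker_def row_minor_def not_False_eq_True)
qed

lemma card_reduced_rows_interval:
  assumes "k \<le> n"
  shows "card (reduced_rows n {j - int k..j - 1}) = k"
proof -
  have "inj_on (\<lambda>m. nat ((m - 1) mod int n)) {j - int k..j - 1}"
  proof (rule inj_onI)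
    fix x y assume x: "x \<in> {j - int k..j - 1}" and y: "y \<in> {j - int k..j - 1}"
      and eq: "nat ((x - 1) mod int n) = nat ((y - 1) mod int n)"
    have n: "0 < int n" using assms x by auto
    have "(x - 1) mod int n = (y - 1) mod int n"
      using eq n by (subst (asm) eq_nat_nat_iff) (auto intro: pos_mod_sign)
    then have "int n dvd x - y" by (metis mod_eq_dvd_iff diff_diff_eq2 diff_add_cancel)
    moreover have "\<bar>x - y\<bar> < int n" using x y assms by auto
    ultimately show "x = y" by (metis dvd_imp_le_int abs_of_nat eq_iff_diff_eq_0 linorder_not_less)
  qed
  then show ?thesis by (simp add: reduced_rows_def card_image)
qed

end

theory Submission
  imports Defs
begin

text \<open>Let \<open>r = k\<^sub>1\<close> and evaluate everything at \<open>x = (-1)\<^sup>r\<^sup>-\<^sup>1 t\<^sub>1\<close>. At this value the first factor is \<open>A \<Phi>\<close>, where the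
  \<open>r\<close> columns of \<open>A\<close> span \<open>N\<^sub>1\<close> (\<open>g_value_factor\<close>). The first \<open>r\<close> columns of the product are therefore
  \<open>A M\<close> with a square matrix \<open>M\<close>, and the only question is whether \<open>M\<close> is invertible. It is as soon
  as the leading \<open>r \<times> r\<close> minor of the product is nonzero.

  This minor is even positive, for the following reason. At \<open>x\<close>, all \<open>r \<times> r\<close> minors of each factor
  \<open>g(N\<^sub>i|t\<^sub>i)\<close> are nonnegative and its leading one is positive (\<open>nonneg_minors_mat_g_value\<close>); by the
  Cauchy-Binet formula both properties pass to products (\<open>nonneg_minors_mat_mult\<close>). The sign
  \<open>(-1)\<^sup>r\<^sup>-\<^sup>1\<close> in \<open>x\<close> is that of a cyclic permutation of \<open>r\<close> rows; it makes the signs of the minors of size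
  \<open>r\<close> invariant under the cyclic symmetry of the matrices.

  Nonnegativity is a statement about one positive point \<open>N|t\<close> of \<open>Gr(k,n)\<close>. Let \<open>V\<close> be a spanning
  matrix of \<open>N\<close> with positive maximal minors. Up to positive factors on the columns, \<open>g(N|t)\<close> at \<open>x\<close>
  consists of maximal minors of \<open>V\<close>, one free row being added to the \<open>k - 1\<close> rows that precede
  \<open>j\<close> cyclically; the entries above the diagonal in the columns from \<open>k\<close> on carry the additional factor
  \<open>\<nu> = (-1)\<^sup>k\<^sup>-\<^sup>1 x / t\<close>, which satisfies \<open>(-1)\<^sup>k\<^sup>+\<^sup>r \<nu> > 0\<close> (\<open>g_value_interval_matrix\<close>). An \<open>r \<times> r\<close> minor of such a
  matrix with \<open>m > max(k, r)\<close> rows misses some row \<open>p\<close>. Cyclic rotation moves \<open>p\<close> to the top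
  (\<open>interval_matrix_rotate\<close>). By the three-term Pluecker relations, the matrix without its top row is the
  matrix of the same kind built from \<open>V\<close> without its top row, multiplied by a nonnegative bidiagonal matrix
  (\<open>interval_matrix_delete_row\<close>), and multiplication by such a matrix preserves nonnegativity of minors
  (\<open>minor_bidiagonal_columns\<close>). In this way \<open>m\<close> descends to \<open>max(k, r)\<close>. If this is \<open>k\<close>, the matrix is diagonal with
  positive entries. Otherwise the minor is the full determinant, which equals \<open>(1 - \<nu>)\<^sup>r\<^sup>-\<^sup>k\<close> times a
  positive number (\<open>det_interval_matrix\<close>); it is nonnegative by the sign of \<open>\<nu>\<close>, and positive if
  \<open>\<nu> \<noteq> 1\<close>. For the factors after the first, \<open>\<nu> \<noteq> 1\<close> because the \<open>t\<^sub>i\<close> are distinct and positive; for the first factor \<open>r = k\<close>.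

  All this takes place in the complex numbers, where \<open>0 < z\<close> says that \<open>z\<close> is real and positive.
  Rows and columns are numbered from 0.\<close>

section \<open>Minors and index sequences\<close>

definition minor :: "(nat \<Rightarrow> nat \<Rightarrow> 'a::comm_ring_1) \<Rightarrow> nat \<Rightarrow> (nat \<Rightarrow> nat) \<Rightarrow> (nat \<Rightarrow> nat) \<Rightarrow> 'a" where
  "minor A r f h = det (mat r r (\<lambda>(a, b). A (f a) (h b)))"

text \<open>Rows and columns of a minor are given by increasing sequences and not by sets, because the
  arguments below shift and rotate the chosen indices.\<close>

definition index_seq :: "nat \<Rightarrow> nat \<Rightarrow> (nat \<Rightarrow> nat) \<Rightarrow> bool" where
  "index_seq r m f \<longleftrightarrow> strict_mono_on {..<r} f \<and> (\<forall>a<r. f a < m)"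

lemma minor_cong:
  assumes "\<And>a b. a < r \<Longrightarrow> b < r \<Longrightarrow> A (f a) (h b) = A' (f' a) (h' b)"
  shows "minor A r f h = minor A' r f' h'"
  unfolding minor_def by (rule arg_cong[of _ _ det], rule cong_mat) (use assms in auto)

lemma index_seqD:
  assumes "index_seq r m f"
  shows "a < b \<Longrightarrow> b < r \<Longrightarrow> f a < f b" "a < r \<Longrightarrow> f a < m" "inj_on f {..<r}" "a < r \<Longrightarrow> a \<le> f a"
proof -
  show 1: "a < b \<Longrightarrow> b < r \<Longrightarrow> f a < f b" for a b
    using assms unfolding index_seq_def strict_mono_on_def by auto
  show "a < r \<Longrightarrow> f a < m" using assms unfolding index_seq_def by auto
  show "inj_on f {..<r}" using assms unfolding index_seq_def by (auto dest: strict_mono_on_imp_inj_on)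
  show "a < r \<Longrightarrow> a \<le> f a"
  proof (induction a)
    case (Suc a) then show ?case using 1[of a "Suc a"] by fastforce
  qed simp
qed

lemma index_seqI:
  assumes "\<And>a b. a < b \<Longrightarrow> b < r \<Longrightarrow> f a < f b" "\<And>a. a < r \<Longrightarrow> f a < m"
  shows "index_seq r m f"
  using assms unfolding index_seq_def strict_mono_on_def by auto

lemma index_seq_full:
  assumes f: "index_seq m m f" and "a < m"
  shows "f a = a"
  using \<open>a < m\<close>
proof (induction "m - a" arbitrary: a rule: less_induct)
  case less
  show ?case
  proof (cases "Suc a < m")
    case True
    then have "f (Suc a) = Suc a" using less by auto
    then show ?thesis using index_seqD(1)[OF f, of a "Suc a"] index_seqD(4)[OF f, of a] True by auto
  next
    case False
    then show ?thesis using index_seqD(2,4)[OF f, of a] less by auto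
  qed
qed

lemma index_seq_pick:
  assumes "S \<subseteq> {..<n}" "card S = r"
  shows "index_seq r n (pick S)" "pick S ` {..<r} = S"
proof -
  have lt: "pick S a \<in> S" if "a < r" for a using pick_in_set_le[of a S] that assms by simp
  then show "index_seq r n (pick S)"
    using assms pick_mono_le[of _ S] by (intro index_seqI) auto
  have "S \<subseteq> pick S ` {..<r}"
  proof
    fix i assume i: "i \<in> S"
    have fin: "finite S" using assms finite_subset by blast
    have "card {a \<in> S. a < i} < card S" by (rule psubset_card_mono) (use i fin in auto)
    then show "i \<in> pick S ` {..<r}" using pick_card_in_set[OF i] assms by (auto simp: image_iff intro!: bexI[of _ "card {a \<in> S. a < i}"])
  qed
  then show "pick S ` {..<r} = S" using lt by auto
qed

lemma pick_index_seq:
  assumes f: "index_seq r n f" and a: "a < r"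
  shows "pick (f ` {..<r}) a = f a"
proof -
  have "{x \<in> f ` {..<r}. x < f a} = f ` {..<a}"
  proof -
    have "b < a" if "b < r" "f b < f a" for b
      using index_seqD(1)[OF f, of a b] that by (metis linorder_neqE_nat less_asym less_irrefl)
    then show ?thesis using index_seqD(1)[OF f] a by force
  qed
  moreover have "card (f ` {..<a}) = a"
    using index_seqD(3)[OF f] a by (subst card_image) (auto intro: inj_on_subset)
  ultimately show ?thesis using pick_card_in_set[of "f a" "f ` {..<r}"] a by auto
qed

lemma det_linear_col:
  assumes c: "c < r"
  shows "det (mat r r (\<lambda>(a, b). if b = c then x * u a + y * w a else F a b)) =
    x * det (mat r r (\<lambda>(a, b). if b = c then u a else F a b)) +
    y * det (mat r r (\<lambda>(a, b). if b = c then w a else F a b))" (is "det (?M (\<lambda>a. x * u a + y * w a)) = _")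
proof -
  have cof: "cofactor (?M v) i c = cofactor (?M v') i c" if "i < r" for v v' i
    unfolding cofactor_def mat_delete_def
    by (intro arg_cong2[of _ _ _ _ "(*)"] arg_cong[of _ _ det] refl cong_mat) (use that c in auto)
  have ex: "det (?M v) = (\<Sum>i<r. v i * cofactor (?M u) i c)" for v
    by (subst laplace_expansion_column[where n = r and j = c])
       (use c cof[of _ v u] in \<open>auto intro!: sum.cong\<close>)
  show ?thesis unfolding ex by (simp add: sum.distrib sum_distrib_left algebra_simps)
qed

lemma det_equal_cols:
  assumes "b < r" "b' < r" "b \<noteq> b'" "\<And>a. a < r \<Longrightarrow> F a b = F a b'"
  shows "det (mat r r (\<lambda>(a, b). F a b)) = 0"
  by (rule det_identical_columns[where i = b and j = b' and n = r]) (use assms in \<open>auto intro!: eq_vecI\<close>)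

lemma det_equal_rows:
  assumes "b < r" "b' < r" "b \<noteq> b'" "\<And>a. a < r \<Longrightarrow> F b a = F b' a"
  shows "det (mat r r (\<lambda>(a, b). F a b)) = 0"
  by (rule det_identical_rows[where i = b and j = b' and n = r]) (use assms in \<open>auto intro!: eq_vecI\<close>)

lemma det_rotate_rows:
  "det (mat (Suc r) (Suc r) (\<lambda>(a, b). F (if a < r then Suc a else 0) b)) =
    (-1) ^ r * det (mat (Suc r) (Suc r) (\<lambda>(a, b). F a b))"
proof -
  have "det (mat (Suc r) (Suc r) (\<lambda>(a, b). F a b)) = (-1) ^ r *
    det (mat (Suc r) (Suc r) (\<lambda>(a, b). F (if a < r then Suc a else 0) b))"
    by (subst det_swap_initial_rows[where k = 1 and n = r and m = "Suc r"])
       (auto intro!: arg_cong[of _ _ "\<lambda>M. _ * det M"] cong_mat)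
  then show ?thesis by (simp add: mult.assoc[symmetric] flip: power_mult_distrib)
qed

lemma det_rotate_cols:
  "det (mat (Suc r) (Suc r) (\<lambda>(a, b). F a (if b < r then Suc b else 0))) =
    (-1) ^ r * det (mat (Suc r) (Suc r) (\<lambda>(a, b). F a b))"
proof -
  have "det (mat (Suc r) (Suc r) (\<lambda>(a, b). F a b)) = (-1) ^ r *
    det (mat (Suc r) (Suc r) (\<lambda>(a, b). F a (if b < r then Suc b else 0)))"
    by (subst det_swap_initial_cols[where k = 1 and n = r and m = "Suc r"])
       (auto intro!: arg_cong[of _ _ "\<lambda>M. _ * det M"] cong_mat)
  then show ?thesis by (simp add: mult.assoc[symmetric] flip: power_mult_distrib)
qed

lemma det_scale_rows_cols:
  "det (mat r r (\<lambda>(a, b). x a * F a b * y b)) =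
    (\<Prod>a<r. x a) * det (mat r r (\<lambda>(a, b). F a b)) * (\<Prod>b<r. y b)"
proof -
  have set: "{0..<r} = {..<r}" by auto
  have lt: "p i < r" if "p permutes {..<r}" "i < r" for p i
    using permutes_in_image[OF that(1), of i] that(2) by simp
  have "(\<Prod>i<r. x i * F i (p i) * y (p i)) = (\<Prod>a<r. x a) * (\<Prod>i<r. F i (p i)) * (\<Prod>b<r. y b)"
    if "p permutes {..<r}" for p
    using prod.permute[OF that, of y] by (simp add: prod.distrib o_def)
  then show ?thesis
    by (subst (1 2) det_def'[where n = r])
       (auto simp: sum_distrib_left sum_distrib_right set lt algebra_simps intro!: sum.cong)
qed

section \<open>The Cauchy-Binet formula\<close>

text \<open>Multilinear expansion in the rows: row \<open>a\<close> of the product is a combination of the rows of \<open>B\<close>, and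
  \<open>\<phi> a\<close> is the one that is picked.\<close>

lemma det_mat_rows_expand:
  fixes A B :: "nat \<Rightarrow> nat \<Rightarrow> 'a::comm_ring_1"
  shows "det (mat r r (\<lambda>(a, b). \<Sum>l<n. A a l * B l b)) =
   (\<Sum>\<phi> | (\<forall>i<r. \<phi> i < n) \<and> (\<forall>i. \<not> i < r \<longrightarrow> \<phi> i = i). 
     (\<Prod>a<r. A a (\<phi> a)) * det (mat r r (\<lambda>(a, b). B (\<phi> a) b)))"
proof -
  define v where "v l = vec r (B l)" for l
  have v: "v l \<in> carrier_vec r" for l by (simp add: v_def)
  have "mat r r (\<lambda>(a, b). \<Sum>l<n. A a l * B l b) =
    mat\<^sub>r r r (\<lambda>i. finsum_vec TYPE('a) r (\<lambda>l. A i l \<cdot>\<^sub>v v l) {..<n})"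
    by (rule eq_matI) (auto simp: index_finsum_vec v_def intro!: sum.cong)
  then have "det (mat r r (\<lambda>(a, b). \<Sum>l<n. A a l * B l b)) = 
    (\<Sum>\<phi> | (\<forall>i<r. \<phi> i < n) \<and> (\<forall>i. \<not> i < r \<longrightarrow> \<phi> i = i). det (mat\<^sub>r r r (\<lambda>i. A i (\<phi> i) \<cdot>\<^sub>v v (\<phi> i))))"
    using det_linear_rows_sum[of "{..<n}" "\<lambda>i l. A i l \<cdot>\<^sub>v v l" r] v
    by (simp add: Ball_def Pi_def)
  also have "\<dots> = (\<Sum>\<phi> | (\<forall>i<r. \<phi> i < n) \<and> (\<forall>i. \<not> i < r \<longrightarrow> \<phi> i = i). 
     (\<Prod>a<r. A a (\<phi> a)) * det (mat r r (\<lambda>(a, b). B (\<phi> a) b)))"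
  proof (rule sum.cong[OF refl])
    fix \<phi> :: "nat \<Rightarrow> nat"
    have "mat\<^sub>r r r (\<lambda>i. v (\<phi> i)) = mat r r (\<lambda>(a, b). B (\<phi> a) b)"
      by (rule eq_matI) (auto simp: v_def)
    then show "det (mat\<^sub>r r r (\<lambda>i. A i (\<phi> i) \<cdot>\<^sub>v v (\<phi> i))) = 
      (\<Prod>a<r. A a (\<phi> a)) * det (mat r r (\<lambda>(a, b). B (\<phi> a) b))"
      by (subst det_rows_mul) (auto simp: v lessThan_atLeast0)
  qed
  finally show ?thesis .
qed

text \<open>Among the choices \<open>\<phi>\<close> of rows only the injective ones contribute, and an injective choice is its
  image \<open>S\<close> together with a permutation; for fixed \<open>S\<close> the sum over the permutations is a minor of \<open>A\<close>.\<close>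

theorem cauchy_binet:
  fixes A B :: "nat \<Rightarrow> nat \<Rightarrow> 'a::comm_ring_1"
  shows "minor (\<lambda>i j. \<Sum>l<n. A i l * B l j) r f h =
    (\<Sum>S | S \<subseteq> {..<n} \<and> card S = r. minor A r f (pick S) * minor B r (pick S) h)"
proof -
  define T where "T = {\<phi>. (\<forall>i<r. \<phi> i < n) \<and> (\<forall>i. \<not> i < r \<longrightarrow> \<phi> i = (i::nat))}"
  define summand where "summand \<phi> = (\<Prod>a<r. A (f a) (\<phi> a)) * det (mat r r (\<lambda>(a, b). B (\<phi> a) (h b)))" for \<phi>
  define T' where "T' = {\<phi> \<in> T. inj_on \<phi> {..<r}}"
  define K where "K = {S. S \<subseteq> {..<n} \<and> card S = r}"
  define Q where "Q = {p. p permutes {..<r}}"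
  define e where "e S p i = (if i < r then pick S (p i) else i)" for S p i
  have "finite {\<phi>. (\<forall>i\<in>{..<r}. \<phi> i \<in> {..<n}) \<and> (\<forall>i. i \<notin> {..<r} \<longrightarrow> \<phi> i = i)}"
    by (rule finite_bounded_functions) auto
  then have finT: "finite T" by (simp add: T_def Ball_def)
  have finK: "finite K" unfolding K_def by (rule finite_subset[of _ "Pow {..<n}"]) auto
  have picks: "bij_betw (pick S) {..<r} S" "pick S ` {..<r} = S" if "S \<in> K" for S
    using index_seq_pick[of S n r] index_seqD(3) that by (auto simp: K_def bij_betw_def)
  have "minor (\<lambda>i j. \<Sum>l<n. A i l * B l j) r f h = sum summand T"
    unfolding minor_def summand_def[abs_def] T_def by (subst det_mat_rows_expand) (rule refl)
  also have "\<dots> = sum summand T'"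
  proof (rule sum.mono_neutral_right[OF finT])
    show "\<forall>\<phi>\<in>T - T'. summand \<phi> = 0"
    proof
      fix \<phi> assume "\<phi> \<in> T - T'"
      then obtain a b where "a < r" "b < r" "a \<noteq> b" "\<phi> a = \<phi> b"
        unfolding T'_def inj_on_def by auto
      then have "det (mat r r (\<lambda>(a, b). B (\<phi> a) (h b))) = 0"
        by (intro det_equal_rows[of a r b]) auto
      then show "summand \<phi> = 0" by (simp add: summand_def)
    qed
  qed (auto simp: T'_def)
  also have "\<dots> = (\<Sum>(S, p)\<in>K \<times> Q. summand (e S p))"
  proof (rule sum.reindex_bij_witness[of _ "\<lambda>(S, p). e S p"
      "\<lambda>\<phi>. (\<phi> ` {..<r}, \<lambda>i. if i < r then inv_into {..<r} (pick (\<phi> ` {..<r})) (\<phi> i) else i)"])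
    fix \<phi> assume phi: "\<phi> \<in> T'"
    let ?S = "\<phi> ` {..<r}"
    let ?p = "\<lambda>i. if i < r then inv_into {..<r} (pick ?S) (\<phi> i) else i"
    have SK: "?S \<in> K" using phi by (auto simp: K_def T'_def T_def card_image)
    have pk: "pick ?S (inv_into {..<r} (pick ?S) (\<phi> i)) = \<phi> i" if "i < r" for i
      using picks(2)[OF SK] that by (intro f_inv_into_f) auto
    show *: "(case (?S, ?p) of (S, p) \<Rightarrow> e S p) = \<phi>"
      using phi pk by (auto simp: e_def T'_def T_def)
    have "bij_betw (inv_into {..<r} (pick ?S) \<circ> \<phi>) {..<r} {..<r}"
      by (rule bij_betw_trans[OF _ bij_betw_inv_into[OF picks(1)[OF SK]]])
         (use phi in \<open>auto simp: T'_def bij_betw_def\<close>)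
    then have "bij_betw ?p {..<r} {..<r}" by (subst bij_betw_cong[where g = "inv_into {..<r} (pick ?S) \<circ> \<phi>"]) auto
    then have "?p permutes {..<r}" by (rule bij_imp_permutes) auto
    then show "(?S, ?p) \<in> K \<times> Q" using SK by (simp add: Q_def)
    show "(case (?S, ?p) of (S, p) \<Rightarrow> summand (e S p)) = summand \<phi>" using * by simp
  next
    fix Sp assume "Sp \<in> K \<times> Q"
    then obtain S p where Sp: "Sp = (S, p)" "S \<in> K" "p permutes {..<r}" by (auto simp: Q_def)
    have lt: "p i < r" if "i < r" for i using permutes_in_image[OF Sp(3), of i] that by simp
    have im: "e S p ` {..<r} = S"
    proof -
      have "e S p ` {..<r} = pick S ` p ` {..<r}" by (auto simp: e_def)
      then show ?thesis using permutes_image[OF Sp(3)] picks(2)[OF Sp(2)] by simp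
    qed
    have inj: "inj_on (e S p) {..<r}"
    proof (rule inj_onI)
      fix i j assume "i \<in> {..<r}" "j \<in> {..<r}" "e S p i = e S p j"
      then have "p i = p j" using picks(1)[OF Sp(2)] lt by (auto simp: e_def bij_betw_def dest: inj_onD)
      then show "i = j" using permutes_inj[OF Sp(3)] by (auto dest: injD)
    qed
    have inv: "inv_into {..<r} (pick S) (e S p i) = p i" if "i < r" for i
      using picks(1)[OF Sp(2)] lt[OF that] that by (auto simp: e_def bij_betw_def intro: inv_into_f_f)
    have out: "p i = i" if "\<not> i < r" for i using permutes_not_in[OF Sp(3), of i] that by simp
    show "(case Sp of (S, p) \<Rightarrow> e S p) \<in> T'"
      using inj picks(2)[OF Sp(2)] lt Sp(2) by (auto simp: Sp(1) T'_def T_def K_def e_def)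
    show "((case Sp of (S, p) \<Rightarrow> e S p) ` {..<r}, \<lambda>i. if i < r then inv_into {..<r}
      (pick ((case Sp of (S, p) \<Rightarrow> e S p) ` {..<r})) ((case Sp of (S, p) \<Rightarrow> e S p) i) else i) = Sp"
      using im inv out by (auto simp: Sp(1))
  qed
  also have "\<dots> = (\<Sum>S\<in>K. \<Sum>p\<in>Q. summand (e S p))" by (rule sum.cartesian_product[symmetric])
  also have "\<dots> = (\<Sum>S\<in>K. minor A r f (pick S) * minor B r (pick S) h)"
  proof (rule sum.cong[OF refl])
    fix S assume S: "S \<in> K"
    have "summand (e S p) = signof p * (\<Prod>a<r. A (f a) (pick S (p a))) * minor B r (pick S) h"
      if p: "p \<in> Q" for p
    proof -
      have lt: "p i < r" if "i < r" for i using permutes_in_image[of p "{..<r}" i] p that by (simp add: Q_def)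
      have "mat r r (\<lambda>(a, b). B (e S p a) (h b)) =
        mat r r (\<lambda>(a, b). mat r r (\<lambda>(a, b). B (pick S a) (h b)) $$ (p a, b))"
        using lt by (intro cong_mat) (auto simp: e_def)
      then have "det (mat r r (\<lambda>(a, b). B (e S p a) (h b))) = signof p * minor B r (pick S) h"
        using p unfolding minor_def
        by (simp add: Q_def det_permute_rows atLeast0LessThan)
      then show ?thesis by (simp add: summand_def e_def mult_ac)
    qed
    moreover have "minor A r f (pick S) = (\<Sum>p\<in>Q. signof p * (\<Prod>a<r. A (f a) (pick S (p a))))"
      unfolding minor_def Q_def
      by (subst det_def'[where n = r]) (auto simp: atLeast0LessThan permutes_in_image intro!: sum.cong prod.cong)
    ultimately show "(\<Sum>p\<in>Q. summand (e S p)) = minor A r f (pick S) * minor B r (pick S) h"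
      by (simp add: sum_distrib_right)
  qed
  finally show ?thesis by (simp add: K_def)
qed

section \<open>Minors of diagonal matrices and of bidiagonal products\<close>

text \<open>Replacing column \<open>j\<close> by a nonnegative combination of columns \<open>j\<close> and \<open>j + 1\<close> keeps minors nonnegative:
  in the expansion the chosen columns stay in increasing order, or two of them coincide. The lower bound
  keeps the term in which no column moves, which is what strict positivity needs later on.\<close>

lemma minor_bidiagonal_columns:
  fixes M :: "nat \<Rightarrow> nat \<Rightarrow> complex"
  assumes nn: "\<And>h. strict_mono_on {..<r} h \<Longrightarrow> 0 \<le> minor M r f h"
    and \<alpha>: "\<And>j. 0 \<le> \<alpha> j" and \<beta>: "\<And>j. 0 \<le> \<beta> j"
    and h: "strict_mono_on {..<r} h"
  shows "(\<Prod>b<r. \<alpha> (h b)) * minor M r f h \<le>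
    minor (\<lambda>i j. \<alpha> j * M i j + \<beta> j * M i (Suc j)) r f h"
proof -
  define N where "N i j = \<alpha> j * M i j + \<beta> j * M i (Suc j)" for i j
  define D where "D c h = det (mat r r (\<lambda>(a, b). if b < c then N (f a) (h b) else M (f a) (h b)))" for c h
  have prod_nn: "0 \<le> (\<Prod>b<c. \<alpha> (h b))" for c :: nat and h
  proof (induction c)
    case (Suc c)
    then show ?case by (simp add: \<alpha> mult_nonneg_nonneg)
  qed (simp add: less_eq_complex_def)
  \<comment> \<open>Columns are replaced from left to right, so that a column that moves to the right meets an old
    column, with which it coincides or which it does not overtake.\<close>
  have "(\<Prod>b<c. \<alpha> (h b)) * minor M r f h \<le> D c h" if "strict_mono_on {..<r} h" "c \<le> r" for c h
    using that
  proof (induction c arbitrary: h)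
    case 0
    then show ?case by (simp add: D_def minor_def)
  next
    case (Suc c)
    define F where "F a b = (if b < c then N (f a) (h b) else M (f a) (h b))" for a b
    define w where "w = det (mat r r (\<lambda>(a, b). if b = c then M (f a) (Suc (h c)) else F a b))"
    have "D (Suc c) h = det (mat r r (\<lambda>(a, b). if b = c
        then \<alpha> (h c) * M (f a) (h c) + \<beta> (h c) * M (f a) (Suc (h c)) else F a b))"
      unfolding D_def by (intro arg_cong[of _ _ det] cong_mat) (auto simp: F_def N_def)
    also have "\<dots> = \<alpha> (h c) * det (mat r r (\<lambda>(a, b). if b = c then M (f a) (h c) else F a b)) + \<beta> (h c) * w"
      unfolding w_def using Suc.prems by (subst det_linear_col) auto
    also have "det (mat r r (\<lambda>(a, b). if b = c then M (f a) (h c) else F a b)) = D c h"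
      unfolding D_def by (intro arg_cong[of _ _ det] cong_mat) (auto simp: F_def)
    finally have D: "D (Suc c) h = \<alpha> (h c) * D c h + \<beta> (h c) * w" .
    \<comment> \<open>\<open>w\<close> is the determinant in which column \<open>c\<close> has moved one step to the right.\<close>
    have "0 \<le> w"
    proof (cases "Suc c < r \<and> h (Suc c) = Suc (h c)")
      case True
      then have "w = 0" unfolding w_def by (intro det_equal_cols[of c r "Suc c"]) (auto simp: F_def)
      then show ?thesis by simp
    next
      case False
      define h' where "h' = h(c := Suc (h c))"
      have mono: "h a < h b" if "a < b" "b < r" for a b
        using Suc.prems(1) that unfolding strict_mono_on_def by auto
      have "strict_mono_on {..<r} h'"
        unfolding strict_mono_on_def
      proof (intro allI impI)
        fix a b assume ab: "a \<in> {..<r} \<and> b \<in> {..<r} \<and> a < b"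
        have "Suc (h c) < h b" if "c < b" "b < r"
        proof (cases "b = Suc c")
          case True
          then show ?thesis using mono[of c "Suc c"] False that by auto
        next
          case b: False
          then show ?thesis using mono[of c "Suc c"] mono[of "Suc c" b] that by auto
        qed
        then show "h' a < h' b" using ab mono[of a b] by (auto simp: h'_def)
      qed
      then have "(\<Prod>b<c. \<alpha> (h' b)) * minor M r f h' \<le> D c h'" "0 \<le> minor M r f h'"
        using Suc nn by auto
      moreover have "D c h' = w"
        unfolding D_def w_def by (intro arg_cong[of _ _ det] cong_mat) (auto simp: F_def h'_def)
      ultimately show ?thesis using prod_nn[of h' c] by (meson mult_nonneg_nonneg order_trans)
    qed
    then have w: "0 \<le> \<beta> (h c) * w" by (intro mult_nonneg_nonneg \<beta>)
    have "\<alpha> (h c) * ((\<Prod>b<c. \<alpha> (h b)) * minor M r f h) \<le> \<alpha> (h c) * D c h"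
      using Suc by (intro mult_left_mono \<alpha>) auto
    then have "\<alpha> (h c) * ((\<Prod>b<c. \<alpha> (h b)) * minor M r f h) \<le> D (Suc c) h"
      unfolding D by (rule order_trans) (use w in simp)
    then show ?case by (simp add: mult_ac)
  qed
  from this[OF h, of r] have "(\<Prod>b<r. \<alpha> (h b)) * minor M r f h \<le> D r h" by simp
  also have "D r h = minor N r f h"
    unfolding D_def minor_def by (rule arg_cong[of _ _ det], rule cong_mat) auto
  finally show ?thesis by (simp only: N_def[abs_def])
qed

lemma minor_diagonal:
  fixes D :: "nat \<Rightarrow> nat \<Rightarrow> 'a::comm_ring_1"
  assumes D: "\<And>i j. i < m \<Longrightarrow> j < m \<Longrightarrow> i \<noteq> j \<Longrightarrow> D i j = 0"
    and f: "index_seq r m f" and h: "index_seq r m h"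
  shows "minor D r f h = (if \<forall>a<r. f a = h a then \<Prod>a<r. D (f a) (f a) else 0)"
proof (cases "\<forall>a<r. f a = h a")
  case True
  have "upper_triangular (mat r r (\<lambda>(a, b). D (f a) (h b)))"
    unfolding upper_triangular_def
  proof (intro allI impI)
    fix a b assume "a < dim_row (mat r r (\<lambda>(a, b). D (f a) (h b)))" "b < a"
    then have ab: "a < r" "b < r" "b < a" by auto
    then have "D (f a) (h b) = 0"
      using True index_seqD(1)[OF f, of b a] index_seqD(2)[OF f, of a] index_seqD(2)[OF f, of b]
      by (intro D) auto
    then show "mat r r (\<lambda>(a, b). D (f a) (h b)) $$ (a, b) = 0" using ab by simp
  qed
  then have "minor D r f h = prod_list (diag_mat (mat r r (\<lambda>(a, b). D (f a) (h b))))"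
    unfolding minor_def by (subst det_upper_triangular) auto
  also have "\<dots> = (\<Prod>a<r. D (f a) (f a))"
    using True by (simp add: diag_mat_def prod.list_conv_set_nth atLeast0LessThan)
  finally show ?thesis using True by simp
next
  case False
  have "f ` {..<r} \<noteq> h ` {..<r}"
  proof
    assume "f ` {..<r} = h ` {..<r}"
    then have "f a = h a" if "a < r" for a
      using pick_index_seq[OF f that] pick_index_seq[OF h that] by simp
    then show False using False by blast
  qed
  moreover have "card (f ` {..<r}) = card (h ` {..<r})"
    using index_seqD(3)[OF f] index_seqD(3)[OF h] by (simp add: card_image)
  ultimately have "\<not> f ` {..<r} \<subseteq> h ` {..<r}" by (metis card_subset_eq finite_imageI finite_lessThan)
  then obtain a where a: "a < r" "f a \<notin> h ` {..<r}" by auto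
  have "minor D r f h = (\<Sum>b<r. D (f a) (h b) * cofactor (mat r r (\<lambda>(a, b). D (f a) (h b))) a b)"
    unfolding minor_def by (subst laplace_expansion_row[where n = r and i = a]) (use a in \<open>auto intro!: sum.cong\<close>)
  also have "\<dots> = 0" 
  proof (rule sum.neutral, rule ballI)
    fix b assume "b \<in> {..<r}"
    then have "D (f a) (h b) = 0" using a index_seqD(2)[OF f, of a] index_seqD(2)[OF h, of b] by (intro D) auto
    then show "D (f a) (h b) * cofactor (mat r r (\<lambda>(a, b). D (f a) (h b))) a b = 0" by simp
  qed
  finally show ?thesis using False by (simp only: if_False)
qed

section \<open>Positive complex numbers\<close>

lemma complex_pos_iff: "0 < z \<longleftrightarrow> (\<exists>x>0. z = complex_of_real x)"
  by (auto simp: less_complex_def complex_eq_iff)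

lemma complex_pos_mult: "0 < x \<Longrightarrow> 0 < y \<Longrightarrow> 0 < x * (y::complex)"
  by (auto simp: less_complex_def)

lemma complex_pos_inverse: "0 < x \<Longrightarrow> 0 < inverse (x::complex)"
  unfolding complex_pos_iff by (metis of_real_inverse positive_imp_inverse_positive)

lemma complex_pos_divide: "0 < x \<Longrightarrow> 0 < y \<Longrightarrow> 0 < x / (y::complex)"
  unfolding divide_inverse by (intro complex_pos_mult complex_pos_inverse)

lemma complex_pos_prod: "(\<And>i. i \<in> A \<Longrightarrow> 0 < F i) \<Longrightarrow> 0 < prod F A" for F :: "'b \<Rightarrow> complex"
  by (induction A rule: infinite_finite_induct) (auto intro: complex_pos_mult simp: less_complex_def)

section \<open>Matrices of interval minors\<close>

definition positive_rows :: "(nat \<Rightarrow> nat \<Rightarrow> complex) \<Rightarrow> nat \<Rightarrow> nat \<Rightarrow> bool" where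
  "positive_rows V m k \<longleftrightarrow> (\<forall>f. index_seq k m f \<longrightarrow> 0 < minor V k f id)"

text \<open>The sequence of \<open>k\<close> rows formed by the \<open>k - 1\<close> rows that precede \<open>j\<close> cyclically modulo \<open>m\<close> and by the
  free row \<open>i\<close>. For \<open>j < k\<close> these are \<open>0, \<dots>, j - 1\<close> and the last \<open>k - 1 - j\<close> rows, and \<open>i\<close> stands between
  the two blocks; for \<open>k \<le> j\<close> it stands last. Where \<open>i\<close> is not in order this causes a sign.\<close>

definition slot :: "nat \<Rightarrow> nat \<Rightarrow> nat \<Rightarrow> nat \<Rightarrow> nat \<Rightarrow> nat" where
  "slot m k j i a = (if j < k then if a < j then a else if a = j then i else m - k + a
     else if Suc a < k then Suc j - k + a else i)"

definition interval_minor :: "(nat \<Rightarrow> nat \<Rightarrow> complex) \<Rightarrow> nat \<Rightarrow> nat \<Rightarrow> nat \<Rightarrow> nat \<Rightarrow> complex" where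
  "interval_minor V m k i j = minor V k (slot m k j i) id"

text \<open>Up to a scaling of the columns this is \<open>g(N|t)\<close> at a value \<open>\<lambda>\<close>, with \<open>\<nu> = (-1)\<^sup>k\<^sup>-\<^sup>1 \<lambda> / t\<close>. The sign
  \<open>(-1)\<^sup>k\<^sup>-\<^sup>1\<close> in \<open>\<nu>\<close> compensates for the position of the row \<open>i\<close> in \<open>slot\<close>. For \<open>\<nu> = 1\<close> all columns lie
  in the column space of \<open>V\<close>.\<close>

definition interval_matrix :: "(nat \<Rightarrow> nat \<Rightarrow> complex) \<Rightarrow> nat \<Rightarrow> nat \<Rightarrow> complex \<Rightarrow> nat \<Rightarrow> nat \<Rightarrow> complex" where
  "interval_matrix V m k \<nu> i j = (if k \<le> j \<and> i < j then \<nu> else 1) * interval_minor V m k i j"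

lemma minor_repeated_row:
  assumes "a < r" "b < r" "a \<noteq> b" "f a = f b"
  shows "minor A r f h = 0"
  unfolding minor_def by (rule det_equal_rows[of a r b]) (use assms in auto)

lemma minor_zero_col:
  assumes "b < r" "\<And>a. a < r \<Longrightarrow> A (f a) (h b) = 0"
  shows "minor A r f h = 0"
proof -
  have "minor A r f h = (\<Sum>a<r. A (f a) (h b) * cofactor (mat r r (\<lambda>(a, b). A (f a) (h b))) a b)"
    unfolding minor_def
    by (subst laplace_expansion_column[where n = r and j = b]) (use assms in \<open>auto intro!: sum.cong\<close>)
  then show ?thesis using assms by simp
qed

lemma interval_minor_pos:
  assumes V: "positive_rows V m k" and "1 \<le> k" "k \<le> m" "j < m"
    and "j \<le> i" "i < m" "j < k \<Longrightarrow> i \<le> m - k + j"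
  shows "0 < interval_minor V m k i j"
proof -
  have "index_seq k m (slot m k j i)"
    using assms by (intro index_seqI) (auto simp: slot_def)
  then show ?thesis using V by (simp add: positive_rows_def interval_minor_def)
qed

text \<open>In these cases \<open>i\<close> is already one of the \<open>k - 1\<close> rows that precede \<open>j\<close>.\<close>

lemma interval_minor_zero:
  assumes "1 \<le> k" "k \<le> m" "j < m" "i < m"
    and "j < k \<Longrightarrow> i < j \<or> m - k + j < i" "k \<le> j \<Longrightarrow> i < j \<and> j < i + k"
  shows "interval_minor V m k i j = 0"
proof (cases "j < k")
  case True
  show ?thesis
  proof (cases "i < j")
    case 1: True
    then show ?thesis unfolding interval_minor_def using True
      by (intro minor_repeated_row[of i _ j]) (auto simp: slot_def)
  next
    case False
    then have "m - k + j < i" using True assms by auto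
    then show ?thesis unfolding interval_minor_def using True assms
      by (intro minor_repeated_row[of "i - (m - k)" _ j]) (auto simp: slot_def)
  qed
next
  case False
  then have "i < j" "j < i + k" using assms by auto
  then show ?thesis unfolding interval_minor_def using False assms
    by (intro minor_repeated_row[of "i + k - Suc j" _ "k - 1"]) (auto simp: slot_def)
qed

text \<open>As a function of the row \<open>V i\<close> an interval minor is a linear form, given by the cofactors along that row.\<close>

lemma interval_minor_linear:
  assumes k: "1 \<le> k"
  obtains \<gamma> where "\<And>i. interval_minor V m k i j = (\<Sum>c<k. V i c * \<gamma> c)"
proof -
  define p where "p = (if j < k then j else k - 1)"
  define M where "M i = mat k k (\<lambda>(a, b). V (slot m k j i a) (id b))" for i
  have p: "p < k" using k by (auto simp: p_def)
  have sl: "slot m k j i p = i" "a \<noteq> p \<Longrightarrow> a < k \<Longrightarrow> slot m k j i a = slot m k j 0 a" for i a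
    by (auto simp: slot_def p_def)
  have cof: "cofactor (M i) p c = cofactor (M 0) p c" if "c < k" for i c
    unfolding cofactor_def mat_delete_def M_def
    by (intro arg_cong2[of _ _ _ _ "(*)"] arg_cong[of _ _ det] refl cong_mat) (use p sl(2)[of _ i] in auto)
  have "interval_minor V m k i j = (\<Sum>c<k. V i c * cofactor (M 0) p c)" for i
    unfolding interval_minor_def minor_def M_def[symmetric]
    by (subst laplace_expansion_row[where n = k and i = p])
       (use p sl(1) cof[of _ i] in \<open>auto simp: M_def intro!: sum.cong\<close>)
  then show ?thesis using that by blast
qed

lemma linear_form_zero:
  fixes V :: "nat \<Rightarrow> nat \<Rightarrow> complex"
  assumes "minor V k s id \<noteq> 0" and z: "\<And>a. a < k \<Longrightarrow> (\<Sum>c<k. V (s a) c * \<delta> c) = 0" and "c < k"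
  shows "\<delta> c = 0"
proof -
  let ?M = "mat k k (\<lambda>(a, b). V (s a) (id b))"
  have "?M *\<^sub>v vec k \<delta> = 0\<^sub>v k"
    by (rule eq_vecI) (auto simp: scalar_prod_def atLeast0LessThan z)
  then have "vec k \<delta> = 0\<^sub>v k"
    using det_0_iff_vec_prod_zero[of ?M k] assms(1) by (auto simp: minor_def intro: vec_carrier)
  then show ?thesis using \<open>c < k\<close> by (metis index_vec index_zero_vec(1))
qed

lemma positive_rows_Suc:
  assumes "positive_rows V (Suc m) k"
  shows "positive_rows (\<lambda>i. V (Suc i)) m k"
  unfolding positive_rows_def
proof (intro allI impI)
  fix f assume "index_seq k m f"
  then have "index_seq k (Suc m) (\<lambda>a. Suc (f a))"
    by (intro index_seqI) (auto dest: index_seqD)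
  then have "0 < minor V k (\<lambda>a. Suc (f a)) id" using assms by (simp add: positive_rows_def)
  then show "0 < minor (\<lambda>i. V (Suc i)) k f id" by (simp add: minor_def)
qed

text \<open>The three-term Pluecker relation for the rows \<open>0\<close>, \<open>j\<close>, \<open>m - k + j + 1\<close> and \<open>i + 1\<close> of \<open>V\<close> and the
  \<open>k - 2\<close> rows common to all three minors. It is obtained without keeping track of signs: the three minors
  are linear forms in row \<open>i + 1\<close> that vanish on the common rows, so the relation has to be checked only on
  the rows \<open>j\<close> and \<open>m - k + j + 1\<close>. On each of these one of the two forms on the right vanishes while the other one and the form
  on the left are positive, which determines the coefficients and their signs.\<close>

lemma interval_minor_three_term:
  assumes V: "positive_rows V (Suc m) k" and k: "k \<le> m" and j: "1 \<le> j" "j < k"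
  obtains \<alpha> \<beta> where "0 < \<alpha>" "0 < \<beta>"
    "\<And>i. interval_minor V (Suc m) k (Suc i) j =
       \<alpha> * interval_minor (\<lambda>i. V (Suc i)) m k i (j - 1) + \<beta> * interval_minor (\<lambda>i. V (Suc i)) m k i j"
proof -
  define V' where "V' i = V (Suc i)" for i
  define b where "b = m - k + j"
  have V': "positive_rows V' m k"
    using positive_rows_Suc[OF V] by (simp add: V'_def[abs_def])
  obtain \<gamma>1 where g1: "\<And>i. interval_minor V (Suc m) k i j = (\<Sum>c<k. V i c * \<gamma>1 c)"
    using interval_minor_linear j by (metis order.trans less_imp_le)
  obtain \<gamma>2 where g2: "\<And>i. interval_minor V' m k i (j - 1) = (\<Sum>c<k. V' i c * \<gamma>2 c)"
    using interval_minor_linear j by (metis order.trans less_imp_le)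
  obtain \<gamma>3 where g3: "\<And>i. interval_minor V' m k i j = (\<Sum>c<k. V' i c * \<gamma>3 c)"
    using interval_minor_linear j by (metis order.trans less_imp_le)
  define L1 where "L1 i = interval_minor V (Suc m) k (Suc i) j" for i
  define L2 where "L2 i = interval_minor V' m k i (j - 1)" for i
  define L3 where "L3 i = interval_minor V' m k i j" for i
  have pos: "0 < L1 (j - 1)" "0 < L1 b" "0 < L2 (j - 1)" "0 < L3 b"
    unfolding L1_def L2_def L3_def using V V' k j
    by (auto intro!: interval_minor_pos simp: b_def)
  have zero: "L2 b = 0" "L3 (j - 1) = 0"
    unfolding L2_def L3_def using k j
    by (auto intro!: interval_minor_zero simp: b_def)
  define \<alpha> where "\<alpha> = L1 (j - 1) / L2 (j - 1)"
  define \<beta> where "\<beta> = L1 b / L3 b"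
  have ab: "0 < \<alpha>" "0 < \<beta>" using pos by (auto simp: \<alpha>_def \<beta>_def intro: complex_pos_divide)
  define \<delta> where "\<delta> c = \<gamma>1 c - \<alpha> * \<gamma>2 c - \<beta> * \<gamma>3 c" for c
  have d: "(\<Sum>c<k. V' i c * \<delta> c) = L1 i - \<alpha> * L2 i - \<beta> * L3 i" for i
    unfolding L1_def L2_def L3_def g1 g2 g3 \<delta>_def V'_def
    by (simp add: algebra_simps sum_subtractf sum_distrib_left)
  \<comment> \<open>The common rows together with rows \<open>j\<close> and \<open>m - k + j + 1\<close> of \<open>V\<close> form a basis.\<close>
  have "\<delta> c = 0" if "c < k" for c
  proof (rule linear_form_zero[of V' k "slot m k j b"])
    show "minor V' k (slot m k j b) id \<noteq> 0"
      using pos(4) by (auto simp: L3_def interval_minor_def)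
    fix a assume a: "a < k"
    let ?i = "slot m k j b a"
    have "L1 ?i - \<alpha> * L2 ?i - \<beta> * L3 ?i = 0"
    proof -
      consider "a < j - 1" | "a = j - 1" | "a = j" | "j < a" by linarith
      then show ?thesis
      proof cases
        case 1
        then have "L1 ?i = 0" "L2 ?i = 0" "L3 ?i = 0"
          unfolding L1_def L2_def L3_def using k j a by (auto intro!: interval_minor_zero simp: slot_def)
        then show ?thesis by simp
      next
        case 2
        then have "?i = j - 1" using j by (simp add: slot_def)
        then show ?thesis using zero(2) pos(3) by (auto simp: \<alpha>_def)
      next
        case 3
        then have "?i = b" using j by (simp add: slot_def)
        then show ?thesis using zero(1) pos(4) by (auto simp: \<beta>_def)
      next
        case 4
        then have "L1 ?i = 0" "L2 ?i = 0" "L3 ?i = 0"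
          unfolding L1_def L2_def L3_def using k j a by (auto intro!: interval_minor_zero simp: slot_def)
        then show ?thesis by simp
      qed
    qed
    then show "(\<Sum>c<k. V' ?i c * \<delta> c) = 0" by (simp add: d)
  qed (use that in auto)
  then have "(\<Sum>c<k. V' i c * \<delta> c) = 0" for i by simp
  then have "L1 i = \<alpha> * L2 i + \<beta> * L3 i" for i by (metis d diff_diff_eq eq_iff_diff_eq_0)
  then show ?thesis using that[of \<alpha> \<beta>] ab unfolding L1_def L2_def L3_def V'_def by blast
qed

section \<open>Removing a row\<close>

text \<open>Without its top row the matrix is a bidiagonal combination of the columns of the smaller matrix
  \<open>H\<close>, whose columns are numbered from 1 to keep the index of the row \<open>j\<close> of \<open>V\<close>; columns \<open>0\<close> and \<open>m + 1\<close> of \<open>H\<close> are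
  padding. The columns from \<open>k\<close> on do not change, since row \<open>0\<close> is none of the \<open>k - 1\<close> rows before \<open>j\<close>.\<close>

lemma interval_matrix_delete_row:
  fixes \<nu> :: complex
  assumes V: "positive_rows V (Suc m) k" and k: "1 \<le> k" "k \<le> m" and j: "j < Suc m"
  defines "H \<equiv> \<lambda>i j. if 1 \<le> j \<and> j < Suc m then interval_matrix (\<lambda>i. V (Suc i)) m k \<nu> i (j - 1) else 0"
  shows "\<exists>\<alpha> \<beta>. 0 \<le> \<alpha> \<and> 0 \<le> \<beta> \<and> (1 \<le> j \<longrightarrow> 0 < \<alpha>) \<and>
    (\<forall>i<m. interval_matrix V (Suc m) k \<nu> (Suc i) j = \<alpha> * H i j + \<beta> * H i (Suc j))"
proof -
  consider "j = 0" | "1 \<le> j" "j < k" | "k \<le> j" by linarith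
  then show ?thesis
  proof cases
    case 1
    have "interval_matrix V (Suc m) k \<nu> (Suc i) 0 = interval_matrix (\<lambda>i. V (Suc i)) m k \<nu> i 0" for i
      using k unfolding interval_matrix_def interval_minor_def
      by (auto intro!: minor_cong simp: slot_def Suc_diff_le)
    then show ?thesis using 1 k by (intro exI[of _ 0] exI[of _ 1]) (simp add: H_def less_complex_def less_eq_complex_def)
  next
    case 2
    obtain \<alpha> \<beta> where ab: "0 < \<alpha>" "0 < \<beta>"
      "\<And>i. interval_minor V (Suc m) k (Suc i) j =
       \<alpha> * interval_minor (\<lambda>i. V (Suc i)) m k i (j - 1) + \<beta> * interval_minor (\<lambda>i. V (Suc i)) m k i j"
      using interval_minor_three_term[OF V k(2) 2] by blast
    then show ?thesis using 2 k
      by (intro exI[of _ \<alpha>] exI[of _ \<beta>]) (auto simp: H_def interval_matrix_def)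
  next
    case 3
    have "interval_matrix V (Suc m) k \<nu> (Suc i) j = interval_matrix (\<lambda>i. V (Suc i)) m k \<nu> i (j - 1)" if "i < m" for i
    proof -
      have eq: "interval_minor V (Suc m) k (Suc i) j = interval_minor (\<lambda>i. V (Suc i)) m k i (j - 1)"
        unfolding interval_minor_def
      proof (rule minor_cong)
        fix a b assume "a < k" "b < k"
        have "slot (Suc m) k j (Suc i) a = Suc (slot m k (j - 1) i a)"
          using k 3 \<open>a < k\<close> by (auto simp: slot_def)
        then show "V (slot (Suc m) k j (Suc i) a) (id b) = V (Suc (slot m k (j - 1) i a)) (id b)" by simp
      qed
      show ?thesis
      proof (cases "j = k \<and> i < j - 1")
        case True
        then have "interval_minor (\<lambda>i. V (Suc i)) m k i (j - 1) = 0"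
          using k that by (intro interval_minor_zero) auto
        then show ?thesis using eq by (simp add: interval_matrix_def)
      next
        case False
        then show ?thesis using eq 3 k by (auto simp: interval_matrix_def)
      qed
    qed
    then show ?thesis using 3 k j
      by (intro exI[of _ 1] exI[of _ 0]) (auto simp: H_def less_complex_def less_eq_complex_def)
  qed
qed

section \<open>Cyclic rotation\<close>

text \<open>The first row becomes the last one, with the sign that keeps the maximal minors positive.\<close>

definition rotate_rows :: "(nat \<Rightarrow> nat \<Rightarrow> complex) \<Rightarrow> nat \<Rightarrow> nat \<Rightarrow> nat \<Rightarrow> nat \<Rightarrow> complex" where
  "rotate_rows V m k i c = (if Suc i < m then V (Suc i) c else (-1) ^ (k - 1) * V 0 c)"

text \<open>The preimage of an index sequence under \<open>i \<mapsto> i + 1\<close> modulo \<open>m\<close>, again in increasing order.\<close>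

definition rotate_seq :: "nat \<Rightarrow> nat \<Rightarrow> (nat \<Rightarrow> nat) \<Rightarrow> nat \<Rightarrow> nat" where
  "rotate_seq m r f a = (if f 0 = 0 then if Suc a < r then f (Suc a) - 1 else m - 1 else f a - 1)"

lemma index_seq_rotate:
  assumes f: "index_seq r m f" and "1 \<le> r"
  shows "index_seq r m (rotate_seq m r f)"
proof (rule index_seqI)
  fix a b assume ab: "a < b" "b < r"
  show "rotate_seq m r f a < rotate_seq m r f b"
  proof (cases "f 0 = 0")
    case True
    have "f 0 < f (Suc a)" "f (Suc a) < m" using index_seqD(1)[OF f, of 0 "Suc a"] index_seqD(2)[OF f, of "Suc a"] ab by auto
    moreover have "f (Suc a) < f (Suc b)" if "Suc b < r" using index_seqD(1)[OF f, of "Suc a" "Suc b"] ab that by auto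
    ultimately show ?thesis using True ab by (auto simp: rotate_seq_def)
  next
    case False
    have "f 0 < f b" "f a < f b" "0 < a \<Longrightarrow> f 0 < f a"
      using index_seqD(1)[OF f, of 0 b] index_seqD(1)[OF f, of a b] index_seqD(1)[OF f, of 0 a] ab by auto
    then show ?thesis using False by (cases "a = 0") (auto simp: rotate_seq_def)
  qed
next
  fix a assume a: "a < r"
  have "f a < m" "Suc a < r \<Longrightarrow> f (Suc a) < m"
    using index_seqD(2)[OF f, of a] index_seqD(2)[OF f, of "Suc a"] a by auto
  then show "rotate_seq m r f a < m" using a by (auto simp: rotate_seq_def)
qed

lemma minor_rotate_rows:
  assumes "1 \<le> r"
  shows "minor A r f h = (-1) ^ (r - 1) * minor A r (\<lambda>a. f (if Suc a < r then Suc a else 0)) h"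
proof -
  obtain s where s: "r = Suc s" using assms by (cases r) auto
  show ?thesis unfolding minor_def s
    by (simp add: det_rotate_rows[of s "\<lambda>a b. A (f a) (h b)"] mult.assoc[symmetric] flip: power_mult_distrib)
qed

lemma minor_rotate_cols:
  assumes "1 \<le> r"
  shows "minor A r f h = (-1) ^ (r - 1) * minor A r f (\<lambda>a. h (if Suc a < r then Suc a else 0))"
proof -
  obtain s where s: "r = Suc s" using assms by (cases r) auto
  show ?thesis unfolding minor_def s
    by (simp add: det_rotate_cols[of s "\<lambda>a b. A (f a) (h b)"] mult.assoc[symmetric] flip: power_mult_distrib)
qed

definition succ_mod :: "nat \<Rightarrow> nat \<Rightarrow> nat" where
  "succ_mod m i = (if Suc i < m then Suc i else 0)"

lemma succ_mod_rotate_seq: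
  assumes f: "index_seq r m f" and a: "a < r"
  shows "succ_mod m (rotate_seq m r f a) = f (if f 0 = 0 then if Suc a < r then Suc a else 0 else a)"
proof (cases "f 0 = 0")
  case True
  show ?thesis
  proof (cases "Suc a < r")
    case s: True
    then have "0 < f (Suc a)" "f (Suc a) < m" using index_seqD(1)[OF f, of 0 "Suc a"] index_seqD(2)[OF f, of "Suc a"] by auto
    then show ?thesis using True s by (auto simp: succ_mod_def rotate_seq_def)
  next
    case s: False
    then show ?thesis using True a by (auto simp: succ_mod_def rotate_seq_def)
  qed
next
  case False
  then have "0 < f a" "f a < m"
    using index_seqD(1)[OF f, of 0 a] index_seqD(2)[OF f, of a] a by (cases "a = 0"; auto)+
  then show ?thesis using False by (auto simp: succ_mod_def rotate_seq_def)
qed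

lemma rotate_seq_last:
  assumes f: "index_seq r m f" and a: "a < r" and r: "1 \<le> r"
  shows "rotate_seq m r f a = m - 1 \<longleftrightarrow> f 0 = 0 \<and> Suc a = r"
proof -
  have "f a < m" "Suc a < r \<Longrightarrow> f (Suc a) < m" "Suc a < r \<Longrightarrow> 0 < f (Suc a)" "0 < a \<Longrightarrow> f 0 < f a"
    using index_seqD(2)[OF f, of a] index_seqD(2)[OF f, of "Suc a"] index_seqD(1)[OF f, of 0 "Suc a"]
      index_seqD(1)[OF f, of 0 a] a by auto
  then show ?thesis using a by (cases "a = 0") (auto simp: rotate_seq_def)
qed

text \<open>Sorting the rotated rows, and likewise the columns, takes a cyclic permutation if index \<open>0\<close> was chosen.\<close>

lemma minor_succ_mod:
  assumes f: "index_seq r m f" and h: "index_seq r m h" and r: "1 \<le> r"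
  shows "minor A r f h = (if f 0 = 0 then (-1) ^ (r - 1) else 1) * (if h 0 = 0 then (-1) ^ (r - 1) else 1) *
    minor (\<lambda>i j. A (succ_mod m i) (succ_mod m j)) r (rotate_seq m r f) (rotate_seq m r h)"
proof -
  define f' where "f' = (\<lambda>a. f (if f 0 = 0 then if Suc a < r then Suc a else 0 else a))"
  define h' where "h' = (\<lambda>a. h (if h 0 = 0 then if Suc a < r then Suc a else 0 else a))"
  have "minor (\<lambda>i j. A (succ_mod m i) (succ_mod m j)) r (rotate_seq m r f) (rotate_seq m r h) = minor A r f' h'"
    by (rule minor_cong) (simp add: succ_mod_rotate_seq[OF f] succ_mod_rotate_seq[OF h] f'_def h'_def)
  moreover have "minor A r f h = (if f 0 = 0 then (-1) ^ (r - 1) else 1) * minor A r f' h"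
    unfolding f'_def using minor_rotate_rows[OF r, of A f h] by simp
  moreover have "minor A r f' h = (if h 0 = 0 then (-1) ^ (r - 1) else 1) * minor A r f' h'"
    unfolding h'_def using minor_rotate_cols[OF r, of A f' h] by simp
  ultimately show ?thesis by simp
qed

lemma minor_scale:
  "minor (\<lambda>i j. x i * A i j * y j) r f h = (\<Prod>a<r. x (f a)) * minor A r f h * (\<Prod>b<r. y (h b))"
  unfolding minor_def by (rule det_scale_rows_cols)

lemma minor_rotate_rows_config:
  "minor (rotate_rows V m k) k f id =
    (\<Prod>a<k. if Suc (f a) < m then 1 else (-1) ^ (k - 1)) * minor V k (\<lambda>a. succ_mod m (f a)) id"
proof -
  define x :: "nat \<Rightarrow> complex" where "x i = (if Suc i < m then 1 else (-1) ^ (k - 1))" for i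
  have "minor (rotate_rows V m k) k f id = minor (\<lambda>i j. x i * V (succ_mod m i) j * 1) k f id"
    by (rule minor_cong) (auto simp: rotate_rows_def x_def succ_mod_def)
  also have "\<dots> = (\<Prod>a<k. x (f a)) * minor V k (\<lambda>a. succ_mod m (f a)) id"
    by (subst minor_scale) (simp add: minor_def)
  finally show ?thesis by (simp add: x_def)
qed

lemma positive_rows_rotate:
  assumes V: "positive_rows V m k" and k: "1 \<le> k"
  shows "positive_rows (rotate_rows V m k) m k"
  unfolding positive_rows_def
proof (intro allI impI)
  fix f assume f: "index_seq k m f"
  define \<epsilon> :: complex where "\<epsilon> = (-1) ^ (k - 1)"
  have e: "\<epsilon> * \<epsilon> = 1" by (simp add: \<epsilon>_def flip: power_mult_distrib)
  define x where "x i = (if Suc i < m then 1 else \<epsilon>)" for i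
  define g where "g a = succ_mod m (f a)" for a
  have *: "minor (rotate_rows V m k) k f id = (\<Prod>a<k. x (f a)) * minor V k g id"
    unfolding x_def \<epsilon>_def g_def by (rule minor_rotate_rows_config)
  have mono: "f a < f b" if "a < b" "b < k" for a b using index_seqD(1)[OF f that] .
  have lt: "f a < m" if "a < k" for a using index_seqD(2)[OF f that] .
  have small: "Suc (f a) < m" if "Suc a < k" for a using mono[of a "Suc a"] lt[of "Suc a"] that by auto
  show "0 < minor (rotate_rows V m k) k f id"
  proof (cases "Suc (f (k - 1)) < m")
    case True
    have sm: "Suc (f a) < m" if "a < k" for a
    proof (cases "Suc a < k")
      case False
      then have "a = k - 1" using that by simp
      then show ?thesis using True by simp
    qed (rule small)
    have "index_seq k m g"
      using mono sm by (intro index_seqI) (auto simp: g_def succ_mod_def)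
    moreover have "(\<Prod>a<k. x (f a)) = 1" using sm by (intro prod.neutral) (auto simp: x_def)
    ultimately show ?thesis using V * by (simp add: positive_rows_def)
  next
    case False
    define g' where "g' a = (if a = 0 then 0 else g (a - 1))" for a
    have "index_seq k m g'"
    proof (rule index_seqI)
      fix a b assume ab: "a < b" "b < k"
      have "Suc (f (b - 1)) < m" using small[of "b - 1"] ab by auto
      moreover have "Suc (f (a - 1)) < m" if "a \<noteq> 0" using small[of "a - 1"] ab that by auto
      moreover have "f (a - 1) < f (b - 1)" if "a \<noteq> 0" using mono[of "a - 1" "b - 1"] ab that by auto
      ultimately show "g' a < g' b" using ab by (auto simp: g'_def g_def succ_mod_def)
    next
      fix a assume "a < k"
      then have "a \<noteq> 0 \<Longrightarrow> Suc (f (a - 1)) < m" using small[of "a - 1"] by auto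
      moreover have "0 < m" using lt[of 0] k by auto
      ultimately show "g' a < m" by (auto simp: g'_def g_def succ_mod_def)
    qed
    then have p: "0 < minor V k g' id" using V by (simp add: positive_rows_def)
    have "minor V k g' id = \<epsilon> * minor V k (\<lambda>a. g' (if Suc a < k then Suc a else 0)) id"
      unfolding \<epsilon>_def by (rule minor_rotate_rows[OF k])
    also have "minor V k (\<lambda>a. g' (if Suc a < k then Suc a else 0)) id = minor V k g id"
    proof (rule minor_cong)
      fix a b assume "a < k" "b < k"
      then have "Suc a < k \<or> a = k - 1" by auto
      then show "V (g' (if Suc a < k then Suc a else 0)) (id b) = V (g a) (id b)"
        using False by (auto simp: g'_def g_def succ_mod_def)
    qed
    finally have "0 < \<epsilon> * minor V k g id" using p by (simp only:)
    moreover have "(\<Prod>a<k. x (f a)) = \<epsilon>"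
    proof -
      have "(\<Prod>a<k. x (f a)) = (\<Prod>a<k. if a = k - 1 then \<epsilon> else 1)"
      proof (rule prod.cong[OF refl])
        fix a assume "a \<in> {..<k}"
        then have "Suc a < k \<or> a = k - 1" by auto
        then show "x (f a) = (if a = k - 1 then \<epsilon> else 1)" using False small[of a] by (auto simp: x_def)
      qed
      then show ?thesis using k by simp
    qed
    ultimately show ?thesis using * by simp
  qed
qed

lemma interval_minor_rotate:
  assumes k: "1 \<le> k" "k < m" and i: "i < m" and j: "k - 1 \<le> j" "j < m - 1"
  shows "interval_minor (rotate_rows V m k) m k i j =
    (if Suc i < m then 1 else (-1) ^ (k - 1)) * interval_minor V m k (succ_mod m i) (Suc j)"
proof -
  have "(\<Prod>a<k. if Suc (slot m k j i a) < m then 1 else (-1) ^ (k - 1)) =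
    (\<Prod>a<k. if a = k - 1 then if Suc i < m then 1 else (-1) ^ (k - 1) else (1::complex))"
    by (rule prod.cong) (use k j in \<open>auto simp: slot_def\<close>)
  also have "\<dots> = (if Suc i < m then 1 else (-1) ^ (k - 1))" using k by simp
  finally have "(\<Prod>a<k. if Suc (slot m k j i a) < m then 1 else (-1) ^ (k - 1)) =
    (if Suc i < m then 1 else (-1) ^ (k - 1) :: complex)" .
  moreover have "minor V k (\<lambda>a. succ_mod m (slot m k j i a)) id = minor V k (slot m k (Suc j) (succ_mod m i)) id"
  proof (rule minor_cong)
    fix a b assume "a < k" "b < k"
    have "succ_mod m (slot m k j i a) = slot m k (Suc j) (succ_mod m i) a"
      using k i j \<open>a < k\<close> by (auto simp: slot_def succ_mod_def)
    then show "V (succ_mod m (slot m k j i a)) (id b) = V (slot m k (Suc j) (succ_mod m i) a) (id b)" by simp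
  qed
  ultimately show ?thesis unfolding interval_minor_def by (simp add: minor_rotate_rows_config)
qed

lemma interval_minor_rotate_wrap:
  assumes k: "1 \<le> k" "k < m" and i: "Suc i < m" and j: "j < k - 1"
  shows "interval_minor (rotate_rows V m k) m k i j = interval_minor V m k (Suc i) (Suc j)"
proof -
  have "(\<Prod>a<k. if Suc (slot m k j i a) < m then 1 else (-1) ^ (k - 1)) =
    (\<Prod>a<k. if a = k - 1 then (-1) ^ (k - 1) else (1::complex))"
    by (rule prod.cong) (use k i j in \<open>auto simp: slot_def\<close>)
  also have "\<dots> = (-1) ^ (k - 1)" using k by simp
  finally have "(\<Prod>a<k. if Suc (slot m k j i a) < m then 1 else (-1) ^ (k - 1)) = ((-1) ^ (k - 1) :: complex)" .
  moreover have "minor V k (\<lambda>a. succ_mod m (slot m k j i a)) id =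
    minor V k (\<lambda>a. slot m k (Suc j) (Suc i) (if Suc a < k then Suc a else 0)) id"
    by (rule minor_cong) (use k i j in \<open>auto simp: slot_def succ_mod_def\<close>)
  ultimately show ?thesis unfolding interval_minor_def
    by (simp add: minor_rotate_rows_config minor_rotate_rows[OF k(1), of V "slot m k (Suc j) (Suc i)"])
qed

lemma interval_minor_rotate_last:
  assumes k: "1 \<le> k" "k < m" and i: "i < m"
  shows "interval_minor (rotate_rows V m k) m k i (m - 1) =
    (if Suc i < m then (-1) ^ (k - 1) else 1) * interval_minor V m k (succ_mod m i) 0"
proof -
  have "(\<Prod>a<k. if Suc (slot m k (m - 1) i a) < m then 1 else (-1) ^ (k - 1)) =
    (\<Prod>a<k. if a = k - 1 then if Suc i < m then 1 else (-1) ^ (k - 1) else (1::complex))"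
    by (rule prod.cong) (use k in \<open>auto simp: slot_def\<close>)
  also have "\<dots> = (if Suc i < m then 1 else (-1) ^ (k - 1))" using k by simp
  finally have "(\<Prod>a<k. if Suc (slot m k (m - 1) i a) < m then 1 else (-1) ^ (k - 1)) =
    (if Suc i < m then 1 else (-1) ^ (k - 1) :: complex)" .
  moreover have "minor V k (\<lambda>a. succ_mod m (slot m k (m - 1) i a)) id =
    minor V k (\<lambda>a. slot m k 0 (succ_mod m i) (if Suc a < k then Suc a else 0)) id"
  proof (rule minor_cong)
    fix a b assume "a < k" "b < k"
    have "succ_mod m (slot m k (m - 1) i a) = slot m k 0 (succ_mod m i) (if Suc a < k then Suc a else 0)"
      using k i \<open>a < k\<close> by (auto simp: slot_def succ_mod_def)
    then show "V (succ_mod m (slot m k (m - 1) i a)) (id b) =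
      V (slot m k 0 (succ_mod m i) (if Suc a < k then Suc a else 0)) (id b)" by simp
  qed
  ultimately show ?thesis unfolding interval_minor_def
    by (simp add: minor_rotate_rows_config minor_rotate_rows[OF k(1), of V "slot m k 0 (succ_mod m i)"]
      mult.assoc[symmetric] flip: power_mult_distrib)
qed

text \<open>Rotation by one step conjugates the matrix, up to scaling one row and the corresponding column by
  \<open>\<mu>\<close> and \<open>1 / \<mu>\<close>. These factors arise because an entry in row \<open>0\<close> that lies above the diagonal lies below it
  once row \<open>0\<close> has become the last row.\<close>

lemma interval_matrix_rotate:
  assumes k: "1 \<le> k" "k < m" and nu: "\<nu> \<noteq> 0" and i: "i < m" and j: "j < m"
  defines "\<mu> \<equiv> \<nu> * (-1) ^ (k - 1)"
  shows "interval_matrix V m k \<nu> (succ_mod m i) (succ_mod m j) =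
    (if i = m - 1 then \<mu> else 1) * interval_matrix (rotate_rows V m k) m k \<nu> i j * (if j = m - 1 then 1 / \<mu> else 1)"
proof -
  have e: "(-1) ^ (k - 1) * (-1) ^ (k - 1) = (1 :: complex)" by (simp flip: power_mult_distrib)
  consider "j < k - 1" "Suc i < m" | "j < k - 1" "i = m - 1" | "k - 1 \<le> j" "j < m - 1" "Suc i < m"
    | "k - 1 \<le> j" "j < m - 1" "i = m - 1" | "j = m - 1" using i j by linarith
  then show ?thesis
  proof cases
    case 1
    then show ?thesis using k interval_minor_rotate_wrap[OF k 1(2,1), of V]
      by (auto simp: interval_matrix_def succ_mod_def)
  next
    case 2
    then have "interval_minor V m k 0 (Suc j) = 0" "interval_minor (rotate_rows V m k) m k i j = 0"
      using k by (auto intro!: interval_minor_zero)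
    then show ?thesis using 2 k by (simp add: interval_matrix_def succ_mod_def)
  next
    case 3
    have "interval_minor (rotate_rows V m k) m k i j = 0" if "j = k - 1" "i < j"
      using k that 3 by (intro interval_minor_zero) auto
    then show ?thesis using k 3 interval_minor_rotate[OF k i 3(1,2), of V]
      by (cases "j = k - 1 \<and> i < j") (auto simp: interval_matrix_def succ_mod_def)
  next
    case 4
    then show ?thesis using k interval_minor_rotate[OF k i 4(1,2), of V] e
      by (auto simp: interval_matrix_def succ_mod_def \<mu>_def)
  next
    case 5
    then show ?thesis using k i nu interval_minor_rotate_last[OF k i, of V] e
      by (auto simp: interval_matrix_def succ_mod_def \<mu>_def field_simps)
  qed
qed

section \<open>The full determinant\<close>

text \<open>At \<open>\<nu> = 1\<close> all columns are combinations of the first \<open>k\<close> ones, and those do not depend on \<open>\<nu>\<close>. Subtracting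
  these combinations leaves in each of the other \<open>m - k\<close> columns a multiple of \<open>\<nu> - 1\<close>. Hence the determinant is a
  constant times \<open>(\<nu> - 1)\<^sup>m\<^sup>-\<^sup>k\<close>, and \<open>\<nu> = 0\<close>, where the matrix is lower triangular, gives the constant.\<close>

lemma det_interval_matrix:
  assumes V: "positive_rows V m k" and k: "1 \<le> k" "k \<le> m"
  shows "det (mat m m (\<lambda>(i, j). interval_matrix V m k \<nu> i j)) = (1 - \<nu>) ^ (m - k) * (\<Prod>j<m. interval_minor V m k j j)"
proof -
  define S where "S = interval_minor V m k"
  have S0: "S i j = 0" if "i < j" "j < k" for i j
    unfolding S_def using that k by (intro interval_minor_zero) auto
  have Sd: "S j j \<noteq> 0" if "j < m" for j
    using interval_minor_pos[OF V k that, of j] that by (auto simp: S_def)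
  have "\<forall>j. \<exists>\<gamma>. \<forall>i. S i j = (\<Sum>c<k. V i c * \<gamma> c)"
    unfolding S_def using interval_minor_linear[OF k(1)] by metis
  then obtain \<gamma> where \<gamma>: "\<And>i j. S i j = (\<Sum>c<k. V i c * \<gamma> j c)" by metis
  define \<Gamma> where "\<Gamma> = mat k k (\<lambda>(c, l). \<gamma> l c)"
  have \<Gamma>: "\<Gamma> \<in> carrier_mat k k" by (simp add: \<Gamma>_def)
  have "mat k k (\<lambda>(i, c). V i c) * \<Gamma> = mat k k (\<lambda>(i, j). S i j)"
    by (rule eq_matI) (auto simp: \<Gamma>_def scalar_prod_def \<gamma> atLeast0LessThan)
  moreover have "det (mat k k (\<lambda>(i, j). S i j)) = (\<Prod>j<k. S j j)"
    by (subst det_lower_triangular[where n = k])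
       (auto simp: S0 diag_mat_def prod.list_conv_set_nth atLeast0LessThan)
  moreover have "(\<Prod>j<k. S j j) \<noteq> 0" using Sd k by simp
  ultimately have d: "det \<Gamma> \<noteq> 0"
    using det_mult[of "mat k k (\<lambda>(i, c). V i c)" k \<Gamma>] \<Gamma> by auto
  \<comment> \<open>The linear forms \<open>\<gamma> j\<close> expressed in the basis \<open>\<gamma> 0, \<dots>, \<gamma> (k - 1)\<close>.\<close>
  define X where "X l j = (\<Sum>c<k. adj_mat \<Gamma> $$ (l, c) * \<gamma> j c) / det \<Gamma>" for l j
  have adj: "(\<Sum>l<k. \<gamma> l c * adj_mat \<Gamma> $$ (l, c')) = (if c = c' then det \<Gamma> else 0)"
    if "c < k" "c' < k" for c c'
  proof -
    have "(\<Gamma> * adj_mat \<Gamma>) $$ (c, c') = (\<Sum>l<k. \<gamma> l c * adj_mat \<Gamma> $$ (l, c'))"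
      using adj_mat(1)[OF \<Gamma>] that by (auto simp: scalar_prod_def \<Gamma>_def atLeast0LessThan)
    then show ?thesis unfolding adj_mat(2)[OF \<Gamma>] using that by (auto split: if_splits)
  qed
  have gX: "(\<Sum>l<k. \<gamma> l c * X l j) = \<gamma> j c" if "c < k" for c j
  proof -
    have "(\<Sum>l<k. \<gamma> l c * X l j) = (\<Sum>l<k. \<Sum>c'<k. \<gamma> l c * adj_mat \<Gamma> $$ (l, c') * \<gamma> j c') / det \<Gamma>"
      by (simp add: X_def sum_distrib_left sum_divide_distrib mult_ac)
    also have "\<dots> = (\<Sum>c'<k. (\<Sum>l<k. \<gamma> l c * adj_mat \<Gamma> $$ (l, c')) * \<gamma> j c') / det \<Gamma>"
      by (subst sum.swap) (simp add: sum_distrib_right)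
    also have "(\<Sum>c'<k. (\<Sum>l<k. \<gamma> l c * adj_mat \<Gamma> $$ (l, c')) * \<gamma> j c') =
      (\<Sum>c'<k. if c = c' then det \<Gamma> * \<gamma> j c' else 0)"
      by (rule sum.cong) (auto simp: adj that)
    finally show ?thesis using that d by simp
  qed
  have SX: "(\<Sum>l<k. S i l * X l j) = S i j" for i j
  proof -
    have "(\<Sum>l<k. S i l * X l j) = (\<Sum>c<k. V i c * (\<Sum>l<k. \<gamma> l c * X l j))"
      unfolding \<gamma>[of i] sum_distrib_left sum_distrib_right
      by (subst sum.swap) (simp add: mult_ac)
    also have "\<dots> = S i j" unfolding \<gamma> by (rule sum.cong) (auto simp: gX)
    finally show ?thesis .
  qed
  \<comment> \<open>The column operations: subtract \<open>\<Sum>l<k. X l j\<close> times column \<open>l\<close> from each column \<open>j \<ge> k\<close>.\<close>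
  define C where "C = mat m m (\<lambda>(l, j). (if l = j then 1 else 0) + (if l < k \<and> k \<le> j then - X l j else 0))"
  define K where "K i j = (if j < k \<or> i < j then S i j else 0)" for i j
  have C: "C \<in> carrier_mat m m" by (simp add: C_def)
  have "upper_triangular C" by (auto simp: upper_triangular_def C_def)
  then have detC: "det C = 1"
    using det_upper_triangular[OF _ C] by (auto simp: C_def diag_mat_def prod.list_conv_set_nth intro!: prod.neutral)
  have *: "det (mat m m (\<lambda>(i, j). interval_matrix V m k \<nu> i j)) = det (mat m m (\<lambda>(i, j). K i j)) * (\<nu> - 1) ^ (m - k)" for \<nu>
  proof -
    have entry: "(\<Sum>l<m. interval_matrix V m k \<nu> i l * C $$ (l, j)) = K i j * (if k \<le> j then \<nu> - 1 else 1)"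
      if ij: "i < m" "j < m" for i j
    proof -
      have "(\<Sum>l<m. interval_matrix V m k \<nu> i l * C $$ (l, j)) =
        (\<Sum>l<m. if l = j then interval_matrix V m k \<nu> i l else 0) + (\<Sum>l<m. if l < k \<and> k \<le> j then - (interval_matrix V m k \<nu> i l * X l j) else 0)"
        unfolding sum.distrib[symmetric] by (rule sum.cong) (use ij in \<open>auto simp: C_def distrib_left\<close>)
      also have "(\<Sum>l<m. if l < k \<and> k \<le> j then - (interval_matrix V m k \<nu> i l * X l j) else 0) =
        (if k \<le> j then - S i j else 0)"
      proof -
        have "(\<Sum>l<m. if l < k \<and> k \<le> j then - (interval_matrix V m k \<nu> i l * X l j) else 0) =
          (\<Sum>l<k. if k \<le> j then - (S i l * X l j) else 0)"
          by (rule sum.mono_neutral_cong_right) (use k in \<open>auto simp: interval_matrix_def S_def\<close>)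
        then show ?thesis by (simp add: SX sum_negf)
      qed
      finally show ?thesis using ij by (auto simp: interval_matrix_def K_def S_def algebra_simps)
    qed
    have "mat m m (\<lambda>(i, j). interval_matrix V m k \<nu> i j) * C = mat m m (\<lambda>(i, j). 1 * K i j * (if k \<le> j then \<nu> - 1 else 1))"
      by (rule eq_matI) (use C entry in \<open>auto simp: scalar_prod_def atLeast0LessThan\<close>)
    then have "det (mat m m (\<lambda>(i, j). interval_matrix V m k \<nu> i j)) =
      det (mat m m (\<lambda>(i, j). 1 * K i j * (if k \<le> j then \<nu> - 1 else 1)))"
      using det_mult[of "mat m m (\<lambda>(i, j). interval_matrix V m k \<nu> i j)" m C] C detC by simp
    also have "\<dots> = det (mat m m (\<lambda>(i, j). K i j)) * (\<Prod>j<m. if k \<le> j then \<nu> - 1 else 1)"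
      by (subst det_scale_rows_cols) simp
    also have "(\<Prod>j<m. if k \<le> j then \<nu> - 1 else 1) = (\<Prod>j\<in>{k..<m}. \<nu> - 1)"
      by (rule prod.mono_neutral_cong_right) auto
    finally show ?thesis by simp
  qed
  have "det (mat m m (\<lambda>(i, j). interval_matrix V m k 0 i j)) = (\<Prod>j<m. S j j)"
    by (subst det_lower_triangular[where n = m])
       (auto simp: S_def[symmetric] S0 interval_matrix_def diag_mat_def prod.list_conv_set_nth atLeast0LessThan)
  with *[of 0] have "(\<Prod>j<m. S j j) = det (mat m m (\<lambda>(i, j). K i j)) * (-1) ^ (m - k)" by simp
  then have "det (mat m m (\<lambda>(i, j). K i j)) = (-1) ^ (m - k) * (\<Prod>j<m. S j j)"
    by (simp add: mult_ac flip: power_mult_distrib)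
  then have "det (mat m m (\<lambda>(i, j). interval_matrix V m k \<nu> i j)) = ((-1) ^ (m - k) * (\<nu> - 1) ^ (m - k)) * (\<Prod>j<m. S j j)"
    using *[of \<nu>] by (simp add: mult_ac)
  then show ?thesis by (simp add: S_def flip: power_mult_distrib)
qed

section \<open>Nonnegativity of the minors\<close>

text \<open>The induction changes \<open>V\<close> and the chosen rows together, so the rows \<open>f\<close> are kept fixed and only the columns
  vary. The principal minor is included to obtain strict positivity.\<close>

definition nonneg_minors_in_rows :: "(nat \<Rightarrow> nat \<Rightarrow> complex) \<Rightarrow> nat \<Rightarrow> nat \<Rightarrow> nat \<Rightarrow> complex \<Rightarrow> (nat \<Rightarrow> nat) \<Rightarrow> bool" where
  "nonneg_minors_in_rows V m k r \<nu> f \<longleftrightarrow>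
    (\<forall>h. index_seq r m h \<longrightarrow> 0 \<le> minor (interval_matrix V m k \<nu>) r f h) \<and>
    (r \<le> k \<or> \<nu> \<noteq> 1 \<longrightarrow> 0 < minor (interval_matrix V m k \<nu>) r f f)"

lemma nonneg_minors_delete:
  assumes V: "positive_rows V (Suc m) k" and k: "1 \<le> k" "k \<le> m"
    and f: "index_seq r (Suc m) f" "\<And>a. a < r \<Longrightarrow> 0 < f a"
    and IH: "nonneg_minors_in_rows (\<lambda>i. V (Suc i)) m k r \<nu> (\<lambda>a. f a - 1)"
  shows "nonneg_minors_in_rows V (Suc m) k r \<nu> f"
proof -
  define V' where "V' = (\<lambda>i. V (Suc i))"
  define H where "H i j = (if 1 \<le> j \<and> j < Suc m then interval_matrix V' m k \<nu> i (j - 1) else 0)" for i j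
  have "\<forall>j. \<exists>\<alpha> \<beta>. 0 \<le> \<alpha> \<and> 0 \<le> \<beta> \<and> (j < Suc m \<longrightarrow> (1 \<le> j \<longrightarrow> 0 < \<alpha>) \<and>
    (\<forall>i<m. interval_matrix V (Suc m) k \<nu> (Suc i) j = \<alpha> * H i j + \<beta> * H i (Suc j)))"
  proof
    fix j
    show "\<exists>\<alpha> \<beta>. 0 \<le> \<alpha> \<and> 0 \<le> \<beta> \<and> (j < Suc m \<longrightarrow> (1 \<le> j \<longrightarrow> 0 < \<alpha>) \<and>
      (\<forall>i<m. interval_matrix V (Suc m) k \<nu> (Suc i) j = \<alpha> * H i j + \<beta> * H i (Suc j)))"
      using interval_matrix_delete_row[OF V k, of j \<nu>] unfolding H_def V'_def
      by (cases "j < Suc m") auto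
  qed
  then obtain \<alpha> \<beta> where ab: "\<And>j. 0 \<le> \<alpha> j" "\<And>j. 0 \<le> \<beta> j"
    "\<And>j. j < Suc m \<Longrightarrow> 1 \<le> j \<Longrightarrow> 0 < \<alpha> j"
    "\<And>i j. j < Suc m \<Longrightarrow> i < m \<Longrightarrow> interval_matrix V (Suc m) k \<nu> (Suc i) j = \<alpha> j * H i j + \<beta> j * H i (Suc j)"
    by metis
  define M where "M i j = H (i - 1) j" for i j
  have mono: "f a < f b" if "a < b" "b < r" for a b using index_seqD(1)[OF f(1) that] .
  have ltf: "f a < Suc m" if "a < r" for a using index_seqD(2)[OF f(1) that] .
  have Mpos: "minor M r f h = minor (interval_matrix V' m k \<nu>) r (\<lambda>a. f a - 1) (\<lambda>a. h a - 1)"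
    if "\<And>b. b < r \<Longrightarrow> 0 < h b \<and> h b < Suc m" for h
    by (rule minor_cong) (use that in \<open>force simp: M_def H_def\<close>)
  have Mnn: "0 \<le> minor M r f h" if h: "strict_mono_on {..<r} h" for h
  proof (cases "\<forall>b<r. 0 < h b \<and> h b < Suc m")
    case True
    have "index_seq r m (\<lambda>a. h a - 1)"
    proof (rule index_seqI)
      fix a b assume "a < b" "b < r"
      then have "h a < h b" "0 < h a" using h True by (auto simp: strict_mono_on_def)
      then show "h a - 1 < h b - 1" by simp
    next
      fix a assume "a < r"
      then have "0 < h a" "h a < Suc m" using True by auto
      then show "h a - 1 < m" by simp
    qed
    then show ?thesis using IH Mpos[of h] True by (simp add: nonneg_minors_in_rows_def V'_def)
  next
    case False
    then obtain b where "b < r" "\<not> (0 < h b \<and> h b < Suc m)" by blast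
    then have "minor M r f h = 0" by (intro minor_zero_col[of b]) (auto simp: M_def H_def)
    then show ?thesis by simp
  qed
  have le: "(\<Prod>b<r. \<alpha> (h b)) * minor M r f h \<le> minor (interval_matrix V (Suc m) k \<nu>) r f h"
    if h: "index_seq r (Suc m) h" for h
  proof -
    have "(\<Prod>b<r. \<alpha> (h b)) * minor M r f h \<le> minor (\<lambda>i j. \<alpha> j * M i j + \<beta> j * M i (Suc j)) r f h"
      by (rule minor_bidiagonal_columns) (use Mnn ab h in \<open>auto simp: index_seq_def\<close>)
    also have "\<dots> = minor (interval_matrix V (Suc m) k \<nu>) r f h"
    proof (rule minor_cong)
      fix a b assume "a < r" "b < r"
      moreover have "f a - 1 < m" "Suc (f a - 1) = f a"
        using f(2)[OF \<open>a < r\<close>] ltf[OF \<open>a < r\<close>] by auto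
      ultimately show "\<alpha> (h b) * M (f a) (h b) + \<beta> (h b) * M (f a) (Suc (h b)) = interval_matrix V (Suc m) k \<nu> (f a) (h b)"
        using ab(4)[of "h b" "f a - 1"] index_seqD(2)[OF h] by (simp add: M_def)
    qed
    finally show ?thesis .
  qed
  show ?thesis
    unfolding nonneg_minors_in_rows_def
  proof (intro conjI allI impI)
    fix h assume h: "index_seq r (Suc m) h"
    have "0 \<le> (\<Prod>b<c. \<alpha> (h b))" for c :: nat
      by (induction c) (auto simp: ab less_eq_complex_def[of 0 1] intro: mult_nonneg_nonneg)
    then show "0 \<le> minor (interval_matrix V (Suc m) k \<nu>) r f h"
      using le[OF h] Mnn[of h] h unfolding index_seq_def by (meson mult_nonneg_nonneg order_trans)
  next
    assume "r \<le> k \<or> \<nu> \<noteq> 1"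
    then have "0 < minor M r f f"
      using IH Mpos[of f] f(2) ltf by (simp add: nonneg_minors_in_rows_def V'_def)
    moreover have "0 < (\<Prod>b<r. \<alpha> (f b))"
      using f(2) ltf by (intro complex_pos_prod ab) (auto simp: Suc_leI)
    ultimately show "0 < minor (interval_matrix V (Suc m) k \<nu>) r f f"
      using le[OF f(1)] complex_pos_mult less_le_trans by blast
  qed
qed

text \<open>The condition \<open>(-1)\<^sup>k\<^sup>+\<^sup>r \<nu> > 0\<close> is what makes rotation harmless: the scaling factor \<open>\<mu>\<close> of the row that
  crosses the boundary has exactly the sign \<open>(-1)\<^sup>r\<^sup>-\<^sup>1\<close> of the cyclic permutation that reorders the chosen
  rows, and the same holds for the columns.\<close>

lemma nonneg_minors_rotate:
  assumes k: "1 \<le> k" "k < m" and r: "1 \<le> r" and nu: "0 < (-1) ^ (k + r) * \<nu>"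
    and f: "index_seq r m f"
    and IH: "nonneg_minors_in_rows (rotate_rows V m k) m k r \<nu> (rotate_seq m r f)"
  shows "nonneg_minors_in_rows V m k r \<nu> f"
proof -
  define \<mu> where "\<mu> = \<nu> * (-1) ^ (k - 1)"
  define s :: complex where "s = (-1) ^ (r - 1)"
  have s2: "s * s = 1" by (simp add: s_def flip: power_mult_distrib)
  have nu0: "\<nu> \<noteq> 0" using nu by auto
  have "(-1) ^ (k + r) = (-1) ^ (k - 1) * (s::complex)"
  proof -
    have "k + r = (k - 1) + (r - 1) + 2" using k r by simp
    then show ?thesis by (simp only: power_add s_def) simp
  qed
  then have smu: "0 < s * \<mu>" using nu by (simp add: \<mu>_def mult_ac)
  have smu': "0 < s * (1 / \<mu>)"
  proof -
    have "inverse s = s" using s2 by (rule inverse_unique)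
    then have "s * (1 / \<mu>) = inverse (s * \<mu>)" by (simp add: inverse_eq_divide[of \<mu>, symmetric] nonzero_inverse_mult_distrib divide_inverse)
    then show ?thesis using complex_pos_inverse[OF smu] by simp
  qed
  have rows: "(\<Prod>a<r. if rotate_seq m r g a = m - 1 then x else 1) = (if g 0 = 0 then x else (1::complex))"
    if g: "index_seq r m g" for g x
  proof -
    have "(\<Prod>a<r. if rotate_seq m r g a = m - 1 then x else 1) = (\<Prod>a<r. if a = r - 1 then if g 0 = 0 then x else 1 else 1)"
    proof (rule prod.cong[OF refl])
      fix a assume "a \<in> {..<r}"
      then have "rotate_seq m r g a = m - 1 \<longleftrightarrow> g 0 = 0 \<and> a = r - 1"
        using rotate_seq_last[OF g _ r, of a] r by auto
      then show "(if rotate_seq m r g a = m - 1 then x else 1) = (if a = r - 1 then if g 0 = 0 then x else 1 else 1)"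
        by simp
    qed
    then show ?thesis using r by simp
  qed
  have *: "\<exists>c>0. minor (interval_matrix V m k \<nu>) r f h = c * minor (interval_matrix (rotate_rows V m k) m k \<nu>) r (rotate_seq m r f) (rotate_seq m r h)"
    if h: "index_seq r m h" for h
  proof -
    let ?G = "minor (interval_matrix (rotate_rows V m k) m k \<nu>) r (rotate_seq m r f) (rotate_seq m r h)"
    have "minor (\<lambda>i j. interval_matrix V m k \<nu> (succ_mod m i) (succ_mod m j)) r (rotate_seq m r f) (rotate_seq m r h) =
      minor (\<lambda>i j. (if i = m - 1 then \<mu> else 1) * interval_matrix (rotate_rows V m k) m k \<nu> i j * (if j = m - 1 then 1 / \<mu> else 1))
        r (rotate_seq m r f) (rotate_seq m r h)"
      unfolding \<mu>_def
      by (rule minor_cong, rule interval_matrix_rotate[OF k nu0])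
         (auto intro: index_seqD(2)[OF index_seq_rotate[OF f r]] index_seqD(2)[OF index_seq_rotate[OF h r]])
    also have "\<dots> = (if f 0 = 0 then \<mu> else 1) * ?G * (if h 0 = 0 then 1 / \<mu> else 1)"
      by (subst minor_scale) (simp only: rows[OF f] rows[OF h])
    finally have "minor (interval_matrix V m k \<nu>) r f h =
      ((if f 0 = 0 then s * \<mu> else 1) * (if h 0 = 0 then s * (1 / \<mu>) else 1)) * ?G"
      using minor_succ_mod[OF f h r, of "interval_matrix V m k \<nu>"] by (simp add: s_def mult_ac)
    moreover have "0 < (if f 0 = 0 then s * \<mu> else 1) * (if h 0 = 0 then s * (1 / \<mu>) else 1)"
      using smu smu' by (intro complex_pos_mult) (auto simp: less_complex_def[of 0 1])
    ultimately show ?thesis by blast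
  qed
  show ?thesis
    unfolding nonneg_minors_in_rows_def
  proof (intro conjI allI impI)
    fix h assume h: "index_seq r m h"
    then show "0 \<le> minor (interval_matrix V m k \<nu>) r f h"
      using *[OF h] IH index_seq_rotate[OF h r]
      by (auto simp: nonneg_minors_in_rows_def intro: mult_nonneg_nonneg less_imp_le)
  next
    assume "r \<le> k \<or> \<nu> \<noteq> 1"
    then show "0 < minor (interval_matrix V m k \<nu>) r f f"
      using *[OF f] IH by (auto simp: nonneg_minors_in_rows_def intro: complex_pos_mult)
  qed
qed

text \<open>Rotation lowers the missing row \<open>p\<close> by one; once it is the top row, it can be removed.\<close>

lemma nonneg_minors_missing_row:
  assumes k: "1 \<le> k" "k \<le> m" and r: "1 \<le> r" and nu: "0 < (-1) ^ (k + r) * \<nu>"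
    and IH: "\<And>V f. positive_rows V m k \<Longrightarrow> index_seq r m f \<Longrightarrow> nonneg_minors_in_rows V m k r \<nu> f"
    and "positive_rows V (Suc m) k" "index_seq r (Suc m) f" "p < Suc m" "p \<notin> f ` {..<r}"
  shows "nonneg_minors_in_rows V (Suc m) k r \<nu> f"
  using assms(6-)
proof (induction p arbitrary: V f)
  case 0
  then have pos: "0 < f a" if "a < r" for a using that by (metis gr0I image_eqI lessThan_iff)
  have "f a - 1 < f b - 1" if "a < b" "b < r" for a b
    using index_seqD(1)[OF 0(2) that] pos[of a] that by (intro diff_less_mono) (auto simp: Suc_leI)
  moreover have "f a - 1 < m" if "a < r" for a using index_seqD(2)[OF 0(2) that] pos[OF that] by auto
  ultimately have "index_seq r m (\<lambda>a. f a - 1)" by (intro index_seqI)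
  then have "nonneg_minors_in_rows (\<lambda>i. V (Suc i)) m k r \<nu> (\<lambda>a. f a - 1)"
    by (rule IH[OF positive_rows_Suc[OF 0(1)]])
  then show ?case by (intro nonneg_minors_delete[OF 0(1) k 0(2)] pos)
next
  case (Suc p)
  have "p \<notin> rotate_seq (Suc m) r f ` {..<r}"
  proof
    assume "p \<in> rotate_seq (Suc m) r f ` {..<r}"
    then obtain a where a: "a < r" "rotate_seq (Suc m) r f a = p" by auto
    define c where "c = (if f 0 = 0 then if Suc a < r then Suc a else 0 else a)"
    have "Suc p = f c"
      using succ_mod_rotate_seq[OF Suc.prems(2) a(1)] a(2) Suc.prems(3) by (simp add: succ_mod_def c_def)
    moreover have "c < r" using a r by (simp add: c_def)
    ultimately show False using Suc.prems(4) by blast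
  qed
  then have "nonneg_minors_in_rows (rotate_rows V (Suc m) k) (Suc m) k r \<nu> (rotate_seq (Suc m) r f)"
    by (intro Suc.IH positive_rows_rotate[OF Suc.prems(1) k(1)] index_seq_rotate[OF Suc.prems(2) r]
      Suc_lessD[OF Suc.prems(3)])
  then show ?case
    by (rule nonneg_minors_rotate[OF k(1) le_imp_less_Suc[OF k(2)] r nu Suc.prems(2)])
qed

text \<open>Rows are removed until \<open>m = max(k, r)\<close>. For \<open>m = k\<close> the matrix is diagonal; for \<open>m = r > k\<close> only the full
  determinant is left, and \<open>(1 - \<nu>)\<^sup>r\<^sup>-\<^sup>k\<close> is an even power if \<open>\<nu> > 0\<close> and a power of a positive number
  if \<open>\<nu> < 0\<close>.\<close>

theorem interval_matrix_minors:
  assumes "positive_rows V m k" and k: "1 \<le> k" "k \<le> m" and r: "1 \<le> r"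
    and nu: "0 < (-1) ^ (k + r) * \<nu>" and "index_seq r m f"
  shows "nonneg_minors_in_rows V m k r \<nu> f"
  using assms(1,3,6)
proof (induction m arbitrary: V f)
  case 0
  then show ?case using k by simp
next
  case (Suc m)
  have rm: "r \<le> Suc m" using index_seqD(2,4)[OF Suc.prems(3), of "r - 1"] r by simp
  consider "k \<le> m" "r \<le> m" | "k = Suc m" | "k \<le> m" "r = Suc m" using Suc.prems(2) rm by linarith
  then show ?case
  proof cases
    case 1
    have "card (f ` {..<r}) < card {..<Suc m}"
      using index_seqD(3)[OF Suc.prems(3)] 1 by (simp add: card_image)
    then have "\<not> {..<Suc m} \<subseteq> f ` {..<r}" by (metis card_mono finite_imageI finite_lessThan linorder_not_less)
    then obtain p where "p < Suc m" "p \<notin> f ` {..<r}" by auto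
    then show ?thesis using nonneg_minors_missing_row[OF k(1) 1(1) r nu] Suc 1 by blast
  next
    case 2
    define G where "G = interval_matrix V (Suc m) k \<nu>"
    have off: "G i j = 0" if "i < Suc m" "j < Suc m" "i \<noteq> j" for i j
      unfolding G_def interval_matrix_def using that 2 by (subst interval_minor_zero) auto
    have diag: "0 < G i i" if "i < Suc m" for i
      unfolding G_def interval_matrix_def using that 2 Suc.prems by (auto intro!: interval_minor_pos)
    have "0 < (\<Prod>a<r. G (f a) (f a))"
      using index_seqD(2)[OF Suc.prems(3)] by (intro complex_pos_prod diag) auto
    then show ?thesis unfolding nonneg_minors_in_rows_def G_def[symmetric]
      using minor_diagonal[OF off Suc.prems(3)] Suc.prems(3) by (auto intro: less_imp_le)
  next
    case 3
    have full: "minor (interval_matrix V (Suc m) k \<nu>) r f h = (1 - \<nu>) ^ (r - k) * (\<Prod>j<r. interval_minor V r k j j)"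
      if "index_seq r (Suc m) h" for h
      using det_interval_matrix[OF Suc.prems(1) k(1) Suc.prems(2), of \<nu>] index_seq_full[of r f] index_seq_full[of r h] Suc.prems(3) that
      unfolding minor_def 3 by (auto intro!: arg_cong[of _ _ det] cong_mat elim!: trans[rotated])
    have pos: "0 < (\<Prod>j<r. interval_minor V r k j j)"
      using Suc.prems k 3 by (intro complex_pos_prod interval_minor_pos) auto
    obtain x where x: "0 < x" "(-1) ^ (k + r) * \<nu> = complex_of_real x" using nu complex_pos_iff by auto
    have "0 \<le> (1 - \<nu>) ^ (r - k) \<and> (\<nu> \<noteq> 1 \<longrightarrow> 0 < (1 - \<nu>) ^ (r - k))"
    proof (cases "even (k + r)")
      case True
      then have "\<nu> = of_real x" using x by simp
      then have eq: "(1 - \<nu>) ^ (r - k) = of_real ((1 - x) ^ (r - k))" by simp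
      have "even (r - k)" using True by simp
      then have "0 \<le> (1 - x) ^ (r - k)" "x \<noteq> 1 \<Longrightarrow> 0 < (1 - x) ^ (r - k)"
        by (auto simp: zero_le_even_power zero_less_power_eq)
      then show ?thesis unfolding eq using \<open>\<nu> = of_real x\<close> by (auto simp: less_complex_def less_eq_complex_def)
    next
      case False
      then have "- \<nu> = of_real x" using x by simp
      then have "\<nu> = - of_real x" by (metis minus_minus)
      then have eq: "(1 - \<nu>) ^ (r - k) = of_real ((1 + x) ^ (r - k))" by simp
      show ?thesis unfolding eq using x(1) by (auto simp: less_complex_def less_eq_complex_def)
    qed
    then show ?thesis unfolding nonneg_minors_in_rows_def
      using pos full[OF Suc.prems(3)] full 3 by (auto intro: mult_nonneg_nonneg less_imp_le complex_pos_mult)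
  qed
qed

section \<open>Pluecker coordinates as interval minors\<close>

lemma row_minor_index_seq:
  assumes A: "A \<in> carrier_mat n k" and f: "index_seq k n f" and I: "reduced_rows n I = f ` {..<k}"
  shows "row_minor n k A I = minor (\<lambda>i c. A $$ (i, c)) k f id"
proof -
  let ?J = "f ` {..<k}"
  have "card ?J = k" using index_seqD(3)[OF f] by (simp add: card_image)
  moreover have "{i. i < n \<and> i \<in> ?J} = ?J" using index_seqD(2)[OF f] by auto
  ultimately have "submatrix A ?J UNIV = mat k k (\<lambda>(a, c). A $$ (f a, c))"
    using A pick_index_seq[OF f] by (auto simp: submatrix_def pick_UNIV intro!: cong_mat)
  then show ?thesis using \<open>card ?J = k\<close> by (simp add: row_minor_def I minor_def)
qed

lemma nat_mod_window:
  assumes "- int n \<le> x" "x < int n"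
  shows "nat (x mod int n) = nat (if x < 0 then x + int n else x)"
proof (cases "x < 0")
  case True
  have "x mod int n = (x + int n) mod int n" by simp
  also have "\<dots> = x + int n" using assms True by (intro mod_pos_pos_trivial) auto
  finally show ?thesis using True by simp
next
  case False
  then show ?thesis using assms by (simp add: mod_pos_pos_trivial)
qed

text \<open>The cyclic index set that occurs in the numerator of \<open>g(N|t)\<close>, with \<open>i + 1\<close> and \<open>j + 1\<close> in place of the
  1-based indices.\<close>

lemma reduced_rows_slot:
  assumes "1 \<le> k" "k \<le> n" "i < n" "j < n"
  shows "reduced_rows n ({int j + 1 - int k + 1..int j + 1 - 1} \<union> {int i + 1}) = slot n k j i ` {..<k}"
    (is "?L = ?R")
proof
  show "?L \<subseteq> ?R"
  proof
    fix y assume "y \<in> ?L"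
    then obtain m where m: "m \<in> {int j + 1 - int k + 1..int j + 1 - 1} \<union> {int i + 1}"
      "y = nat ((m - 1) mod int n)" unfolding reduced_rows_def by blast
    have y: "y = nat (if m - 1 < 0 then m - 1 + int n else m - 1)"
      unfolding m(2) by (rule nat_mod_window) (use m assms in auto)
    have "\<exists>a<k. y = slot n k j i a"
    proof (cases "m = int i + 1")
      case True
      then have "y = slot n k j i (if j < k then j else k - 1)" using y assms by (auto simp: slot_def)
      then show ?thesis using assms by (intro exI[of _ "if j < k then j else k - 1"]) auto
    next
      case False
      then have r: "int j + 1 - int k \<le> m - 1" "m - 1 \<le> int j - 1" using m(1) by auto
      define a where "a = (if k \<le> j then nat (m - 1 - (int j + 1 - int k)) else
        if m - 1 < 0 then nat (m - 1 + int k) else nat (m - 1))"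
      have "a < k \<and> y = slot n k j i a"
        using r y assms by (auto simp: a_def slot_def nat_less_iff split: if_splits)
      then show ?thesis by blast
    qed
    then show "y \<in> ?R" by blast
  qed
  show "?R \<subseteq> ?L"
  proof
    fix y assume "y \<in> ?R"
    then obtain a where a: "a < k" "y = slot n k j i a" by auto
    define m where "m = (if k \<le> j then if Suc a < k then int j + 1 - int k + int a + 1 else int i + 1
      else if a < j then int a + 1 else if a = j then int i + 1 else int a - int k + 1)"
    have m: "m \<in> {int j + 1 - int k + 1..int j + 1 - 1} \<union> {int i + 1}"
      using a assms by (auto simp: m_def)
    have "nat ((m - 1) mod int n) = nat (if m - 1 < 0 then m - 1 + int n else m - 1)"
      by (rule nat_mod_window) (use m assms in auto)
    also have "\<dots> = y" using a assms by (auto simp: m_def slot_def)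
    finally show "y \<in> ?L" using m unfolding reduced_rows_def by (intro image_eqI[of _ _ m]) simp_all
  qed
qed

text \<open>The sign appears where the free row \<open>i\<close> precedes the other rows but stands last in \<open>slot\<close>: a cyclic
  permutation of \<open>k\<close> rows restores the order.\<close>

lemma row_minor_interval:
  assumes A: "A \<in> carrier_mat n k" and k: "1 \<le> k" "k \<le> n" and i: "i < n" and j: "j < n"
  shows "row_minor n k A ({int j + 1 - int k + 1..int j + 1 - 1} \<union> {int i + 1}) =
    (if k \<le> j \<and> i < j then (-1) ^ (k - 1) else 1) * interval_minor (\<lambda>i c. A $$ (i, c)) n k i j"
proof -
  let ?s = "slot n k j i"
  note red = reduced_rows_slot[OF k i j]
  show ?thesis
  proof (cases "inj_on ?s {..<k}")
    case False
    then have "card (?s ` {..<k}) \<noteq> k" using eq_card_imp_inj_on[of "{..<k}" ?s] by auto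
    moreover obtain a b where "a < k" "b < k" "a \<noteq> b" "?s a = ?s b" using False by (auto simp: inj_on_def)
    then have "interval_minor (\<lambda>i c. A $$ (i, c)) n k i j = 0"
      unfolding interval_minor_def by (intro minor_repeated_row[of a k b])
    ultimately show ?thesis unfolding row_minor_def red by simp
  next
    case inj: True
    show ?thesis
    proof (cases "k \<le> j \<and> i < j")
      case False
      have "j \<le> i \<and> i \<le> n - k + j" if "j < k"
      proof (rule ccontr)
        assume "\<not> (j \<le> i \<and> i \<le> n - k + j)"
        then have "i < j \<or> n - k + j < i" by linarith
        then show False
        proof
          assume "i < j"
          then show False using inj_onD[OF inj, of i j] that by (simp add: slot_def)
        next
          assume far: "n - k + j < i"
          define a where "a = i - (n - k)"
          have a: "j < a" "a < k" "n - k + a = i" using far i k by (auto simp: a_def)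
          then have "?s a = ?s j" using that by (simp add: slot_def)
          then show False using inj_onD[OF inj, of a j] a that by simp
        qed
      qed
      then have "index_seq k n ?s"
        using False k i j by (intro index_seqI) (auto simp: slot_def)
      then show ?thesis using False row_minor_index_seq[OF A _ red] by (auto simp: interval_minor_def)
    next
      case True
      have ij: "i + k \<le> j"
      proof (rule ccontr)
        assume near: "\<not> i + k \<le> j"
        define a where "a = i + k - Suc j"
        have a: "Suc a < k" "Suc j - k + a = i" using near True k by (auto simp: a_def)
        then have "?s a = ?s (k - 1)" using True by (simp add: slot_def)
        then show False using inj_onD[OF inj, of a "k - 1"] a by simp
      qed
      define g where "g a = ?s (if a = 0 then k - 1 else a - 1)" for a
      have g: "index_seq k n g"
        using ij k i j True by (intro index_seqI) (auto simp: g_def slot_def)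
      have "g ` {..<k} = ?s ` {..<k}"
      proof
        show "g ` {..<k} \<subseteq> ?s ` {..<k}" using k by (auto simp: g_def)
        show "?s ` {..<k} \<subseteq> g ` {..<k}"
        proof
          fix y assume "y \<in> ?s ` {..<k}"
          then obtain a where a: "a < k" "y = ?s a" by auto
          then have "y = g (if Suc a < k then Suc a else 0)"
            by (auto simp: g_def intro!: arg_cong[of _ _ ?s])
          then show "y \<in> g ` {..<k}" using k by (auto intro!: imageI)
        qed
      qed
      then have "row_minor n k A ({int j + 1 - int k + 1..int j + 1 - 1} \<union> {int i + 1}) =
        minor (\<lambda>i c. A $$ (i, c)) k g id"
        by (intro row_minor_index_seq[OF A g]) (simp only: red)
      also have "\<dots> = (-1) ^ (k - 1) * minor (\<lambda>i c. A $$ (i, c)) k (\<lambda>a. g (if Suc a < k then Suc a else 0)) id"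
        by (rule minor_rotate_rows[OF k(1)])
      also have "minor (\<lambda>i c. A $$ (i, c)) k (\<lambda>a. g (if Suc a < k then Suc a else 0)) id =
        interval_minor (\<lambda>i c. A $$ (i, c)) n k i j"
        unfolding interval_minor_def
      proof (rule minor_cong)
        fix a b assume "a < k" "b < k"
        then have "g (if Suc a < k then Suc a else 0) = ?s a"
          by (auto simp: g_def intro!: arg_cong[of _ _ ?s])
        then show "A $$ (g (if Suc a < k then Suc a else 0), id b) = A $$ (?s a, id b)" by simp
      qed
      finally show ?thesis using True by simp
    qed
  qed
qed

lemma column_span_mult_invertible:
  assumes A: "A \<in> carrier_mat n k" and M: "M \<in> carrier_mat k k" and d: "det M \<noteq> 0"
  shows "column_span n (A * M) = column_span n A" "vec_space.rank n (A * M) = vec_space.rank n A"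
proof -
  interpret vec_space "TYPE(complex)" n .
  define B where "B = inverse (det M) \<cdot>\<^sub>m adj_mat M"
  have B: "B \<in> carrier_mat k k" using adj_mat(1)[OF M] by (simp add: B_def)
  have MB: "M * B = 1\<^sub>m k"
    unfolding B_def mult_smult_distrib[OF M adj_mat(1)[OF M]] adj_mat(2)[OF M]
    by (rule eq_matI) (use d in auto)
  have AM: "A * M \<in> carrier_mat n k" using A M by simp
  show *: "column_span n (A * M) = column_span n A"
    unfolding col_space_eq[OF AM] col_space_eq[OF A]
  proof (rule Collect_cong)
    fix y :: "complex vec"
    have "(\<exists>x\<in>carrier_vec (dim_col (A * M)). A * M *\<^sub>v x = y) \<longleftrightarrow> (\<exists>x\<in>carrier_vec (dim_col A). A *\<^sub>v x = y)"
    proof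
      assume "\<exists>x\<in>carrier_vec (dim_col (A * M)). A * M *\<^sub>v x = y"
      then obtain x where x: "x \<in> carrier_vec k" "A * M *\<^sub>v x = y" using M by auto
      then have "A *\<^sub>v (M *\<^sub>v x) = y" using assoc_mult_mat_vec[OF A M] by simp
      moreover have "M *\<^sub>v x \<in> carrier_vec (dim_col A)" using A mult_mat_vec_carrier[OF M x(1)] by simp
      ultimately show "\<exists>x\<in>carrier_vec (dim_col A). A *\<^sub>v x = y" by blast
    next
      assume "\<exists>x\<in>carrier_vec (dim_col A). A *\<^sub>v x = y"
      then obtain x where x: "x \<in> carrier_vec k" "A *\<^sub>v x = y" using A by auto
      have Bx: "B *\<^sub>v x \<in> carrier_vec k" by (rule mult_mat_vec_carrier[OF B x(1)])
      have "A * M *\<^sub>v (B *\<^sub>v x) = A *\<^sub>v (M *\<^sub>v (B *\<^sub>v x))" by (rule assoc_mult_mat_vec[OF A M Bx])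
      also have "M *\<^sub>v (B *\<^sub>v x) = x" using assoc_mult_mat_vec[OF M B x(1)] MB x(1) by simp
      finally show "\<exists>x\<in>carrier_vec (dim_col (A * M)). A * M *\<^sub>v x = y"
        using x(2) Bx M by (intro bexI[of _ "B *\<^sub>v x"]) auto
    qed
    then show "y \<in> carrier_vec (dim_row (A * M)) \<and> (\<exists>x\<in>carrier_vec (dim_col (A * M)). A * M *\<^sub>v x = y) \<longleftrightarrow>
      y \<in> carrier_vec (dim_row A) \<and> (\<exists>x\<in>carrier_vec (dim_col A). A *\<^sub>v x = y)" by simp
  qed
  show "rank (A * M) = rank A" using * unfolding rank_def col_space_def by simp
qed

text \<open>The common scalar of the Pluecker coordinates can be absorbed into the first column of a spanning matrix.\<close>

lemma positive_spanning_matrix: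
  assumes k: "1 \<le> k" "k \<le> n" and X: "(N, t) \<in> XX n k" and pos: "positive_point n k (N, t)"
  obtains A where "spanning_matrix n k N A" "positive_rows (\<lambda>i c. A $$ (i, c)) n k"
proof -
  have n: "0 < n" using k by simp
  obtain A where A: "spanning_matrix n k N A" using X by (auto simp: XX_def Gr_def)
  then have Ac: "A \<in> carrier_mat n k" by (simp add: spanning_matrix_def)
  obtain c where c: "c \<noteq> 0" "\<And>I. plucker n k N I = c * row_minor n k A I"
    using plucker_unique[OF n A] by blast
  obtain c' where c': "c' \<noteq> 0" "\<And>J. J \<subseteq> {1..int n} \<Longrightarrow> card J = k \<Longrightarrow> 0 < c' * plucker n k N J"
    using pos unfolding positive_point_def by blast
  define e where "e = c' * c"
  define D where "D = mat k k (\<lambda>(i, j). if i = j then if i = 0 then e else 1 else (0::complex))"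
  have D: "D \<in> carrier_mat k k" by (simp add: D_def)
  have "upper_triangular D" by (auto simp: upper_triangular_def D_def)
  then have "det D = (\<Prod>i<k. if i = 0 then e else 1)"
    using det_upper_triangular[OF _ D] by (simp add: D_def diag_mat_def prod.list_conv_set_nth atLeast0LessThan)
  then have detD: "det D = e" using k by simp
  then have "det D \<noteq> 0" using c c' by (simp add: e_def)
  have AD: "A * D \<in> carrier_mat n k" by (rule mult_carrier_mat[OF Ac D])
  have span: "spanning_matrix n k N (A * D)"
    using column_span_mult_invertible[OF Ac D \<open>det D \<noteq> 0\<close>] A AD by (simp add: spanning_matrix_def)
  have "positive_rows (\<lambda>i c. (A * D) $$ (i, c)) n k"
    unfolding positive_rows_def
  proof (intro allI impI)
    fix f assume f: "index_seq k n f"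
    define J where "J = (\<lambda>a. int (f a) + 1) ` {..<k}"
    have lt: "f a < n" if "a < k" for a using index_seqD(2)[OF f that] .
    have "inj_on (\<lambda>a. int (f a) + 1) {..<k}" using index_seqD(3)[OF f] by (auto simp: inj_on_def)
    then have "card J = k" by (simp add: J_def card_image)
    moreover have "J \<subseteq> {1..int n}" using lt by (force simp: J_def)
    ultimately have "0 < c' * plucker n k N J" by (rule c'(2)[rotated])
    then have "0 < row_minor n k A J * e" by (simp add: c e_def mult_ac)
    then have "0 < row_minor n k (A * D) J" using row_minor_mult[OF n Ac D] detD by simp
    moreover have "reduced_rows n J = f ` {..<k}"
      unfolding reduced_rows_def J_def image_image by (rule image_cong) (use lt in auto)
    ultimately show "0 < minor (\<lambda>i c. (A * D) $$ (i, c)) k f id"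
      using row_minor_index_seq[OF AD f] by simp
  qed
  then show ?thesis using span that by blast
qed


section \<open>Products and evaluation\<close>

definition nonneg_minors_mat :: "nat \<Rightarrow> nat \<Rightarrow> complex mat \<Rightarrow> bool" where
  "nonneg_minors_mat n r E \<longleftrightarrow> E \<in> carrier_mat n n \<and>
    (\<forall>f h. index_seq r n f \<longrightarrow> index_seq r n h \<longrightarrow> 0 \<le> minor (\<lambda>i j. E $$ (i, j)) r f h) \<and>
    0 < minor (\<lambda>i j. E $$ (i, j)) r id id"

lemma index_seq_id: "r \<le> n \<Longrightarrow> index_seq r n id"
  by (intro index_seqI) auto

text \<open>In the Cauchy-Binet expansion of the leading minor the summand for the first \<open>r\<close> indices is already
  positive.\<close>

lemma nonneg_minors_mat_mult:
  assumes A: "nonneg_minors_mat n r A" and B: "nonneg_minors_mat n r B" and r: "r \<le> n"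
  shows "nonneg_minors_mat n r (A * B)"
proof -
  have Ac: "A \<in> carrier_mat n n" and Bc: "B \<in> carrier_mat n n" using A B by (auto simp: nonneg_minors_mat_def)
  let ?K = "{S. S \<subseteq> {..<n} \<and> card S = r}"
  let ?t = "\<lambda>f h S. minor (\<lambda>i j. A $$ (i, j)) r f (pick S) * minor (\<lambda>i j. B $$ (i, j)) r (pick S) h"
  have eq: "minor (\<lambda>i j. (A * B) $$ (i, j)) r f h = (\<Sum>S\<in>?K. ?t f h S)"
    if f: "index_seq r n f" and h: "index_seq r n h" for f h
  proof -
    have "minor (\<lambda>i j. (A * B) $$ (i, j)) r f h = minor (\<lambda>i j. \<Sum>l<n. A $$ (i, l) * B $$ (l, j)) r f h"
      by (rule minor_cong)
         (use Ac Bc index_seqD(2)[OF f] index_seqD(2)[OF h] in \<open>simp add: scalar_prod_def atLeast0LessThan\<close>)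
    then show ?thesis by (simp add: cauchy_binet)
  qed
  have nn: "0 \<le> ?t f h S" if "index_seq r n f" "index_seq r n h" "S \<in> ?K" for f h S
    using that A B index_seq_pick(1)[of S n r] by (auto simp: nonneg_minors_mat_def intro!: mult_nonneg_nonneg)
  have fin: "finite ?K" by (rule finite_subset[of _ "Pow {..<n}"]) auto
  have id: "index_seq r n id" using r by (rule index_seq_id)
  have "0 < (\<Sum>S\<in>?K. ?t id id S)"
  proof -
    have K: "{..<r} \<in> ?K" using r by auto
    have pick: "pick {..<r} a = a" if "a < r" for a
      using pick_index_seq[OF id that] by simp
    have "minor (\<lambda>i j. A $$ (i, j)) r id (pick {..<r}) = minor (\<lambda>i j. A $$ (i, j)) r id id"
      "minor (\<lambda>i j. B $$ (i, j)) r (pick {..<r}) id = minor (\<lambda>i j. B $$ (i, j)) r id id"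
      by (rule minor_cong, simp add: pick)+
    then have "0 < ?t id id {..<r}"
      using A B by (auto simp: nonneg_minors_mat_def intro: complex_pos_mult)
    also have "\<dots> \<le> (\<Sum>S\<in>?K. ?t id id S)"
      by (rule member_le_sum[OF K _ fin]) (use nn[OF id id] in auto)
    finally show ?thesis .
  qed
  then show ?thesis
    unfolding nonneg_minors_mat_def
  proof (intro conjI allI impI)
    show "A * B \<in> carrier_mat n n" by (rule mult_carrier_mat[OF Ac Bc])
    show "0 < minor (\<lambda>i j. (A * B) $$ (i, j)) r id id"
      unfolding eq[OF id id] using \<open>0 < (\<Sum>S\<in>?K. ?t id id S)\<close> .
    fix f h assume f: "index_seq r n f" and h: "index_seq r n h"
    show "0 \<le> minor (\<lambda>i j. (A * B) $$ (i, j)) r f h"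
      unfolding eq[OF f h] by (rule sum_nonneg) (rule nn[OF f h])
  qed
qed

lemma nonneg_minors_mat_one:
  assumes "r \<le> n"
  shows "nonneg_minors_mat n r (1\<^sub>m n)"
proof -
  have "minor (\<lambda>i j. 1\<^sub>m n $$ (i, j)) r f h = (if \<forall>a<r. f a = h a then 1 else (0::complex))"
    if f: "index_seq r n f" and h: "index_seq r n h" for f h
  proof -
    have "minor (\<lambda>i j. 1\<^sub>m n $$ (i, j)) r f h =
      (if \<forall>a<r. f a = h a then \<Prod>a<r. 1\<^sub>m n $$ (f a, f a) else (0::complex))"
      by (rule minor_diagonal[OF _ f h]) auto
    also have "(\<Prod>a<r. 1\<^sub>m n $$ (f a, f a)) = (1::complex)"
      using index_seqD(2)[OF f] by (intro prod.neutral) auto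
    finally show ?thesis .
  qed
  then show ?thesis using index_seq_id[OF assms]
    by (auto simp: nonneg_minors_mat_def less_complex_def less_eq_complex_def)
qed

text \<open>The entries of the matrices are polynomials in \<open>\<lambda>\<close>, so evaluation is a ring homomorphism on them and
  commutes with matrix products.\<close>

definition polynomial_value :: "nat \<Rightarrow> complex \<Rightarrow> ratfun mat \<Rightarrow> complex mat \<Rightarrow> bool" where
  "polynomial_value n x F E \<longleftrightarrow>
    (\<exists>Q\<in>carrier_mat n n. F = map_mat to_fract Q \<and> E = map_mat (\<lambda>q. poly q x) Q)"

lemma polynomial_value_mult:
  assumes "polynomial_value n x F E" "polynomial_value n x F' E'"
  shows "polynomial_value n x (F * F') (E * E')"
proof -
  interpret frac: comm_ring_hom "to_fract :: complex poly \<Rightarrow> ratfun" by unfold_locales auto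
  interpret ev: comm_ring_hom "\<lambda>q. poly q x" by unfold_locales auto
  obtain Q Q' where Q: "Q \<in> carrier_mat n n" "Q' \<in> carrier_mat n n"
    "F = map_mat to_fract Q" "E = map_mat (\<lambda>q. poly q x) Q"
    "F' = map_mat to_fract Q'" "E' = map_mat (\<lambda>q. poly q x) Q'"
    using assms unfolding polynomial_value_def by auto
  then show ?thesis unfolding polynomial_value_def
    using frac.mat_hom_mult[OF Q(1,2)] ev.mat_hom_mult[OF Q(1,2)]
    by (intro bexI[of _ "Q * Q'"]) auto
qed

lemma polynomial_value_one: "polynomial_value n x (1\<^sub>m n) (1\<^sub>m n)"
  unfolding polynomial_value_def by (intro bexI[of _ "1\<^sub>m n"] conjI) (auto intro!: eq_matI)

lemma polynomial_value_eval:
  assumes "polynomial_value n x F E"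
  shows "F \<in> carrier_mat n n" "eval_mat x F = E" "elements_mat F \<subseteq> laurent_polys"
proof -
  obtain Q where Q: "Q \<in> carrier_mat n n" "F = map_mat to_fract Q" "E = map_mat (\<lambda>q. poly q x) Q"
    using assms unfolding polynomial_value_def by auto
  show "F \<in> carrier_mat n n" using Q by simp
  have "eval_rf x (to_fract q) = poly q x" for q
    using eval_rf_Fract[of 1 x q] by (simp add: to_fract_def)
  then show "eval_mat x F = E" unfolding Q eval_mat_def by (auto intro!: eq_matI)
  have "to_fract q \<in> laurent_polys" for q
    unfolding laurent_polys_def by (rule CollectI) (rule exI[of _ q], rule exI[of _ 0], simp)
  then show "elements_mat F \<subseteq> laurent_polys" using Q by (auto simp: elements_mat_def)
qed


text \<open>The matrix \<open>g(N|t)\<close> at \<open>\<lambda> = x\<close>, with 0-based indices.\<close>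

definition g_value :: "nat \<Rightarrow> nat \<Rightarrow> point \<Rightarrow> complex \<Rightarrow> complex mat" where
  "g_value n k p x = mat n n (\<lambda>(i, j). (if j < k then 1 else if j \<le> i then snd p else x) *
     (plucker n k (fst p) ({int j + 1 - int k + 1..int j + 1 - 1} \<union> {int i + 1}) /
      plucker n k (fst p) {int j + 1 - int k..int j + 1 - 1}))"

lemma polynomial_value_g_mat: "polynomial_value n x (g_mat n k p) (g_value n k p x)"
proof -
  define Q where "Q = mat n n (\<lambda>(i, j). (if j < k then 1 else if j \<le> i then [:snd p:] else [:0, 1:]) *
     [:plucker n k (fst p) ({int j + 1 - int k + 1..int j + 1 - 1} \<union> {int i + 1}) /
      plucker n k (fst p) {int j + 1 - int k..int j + 1 - 1}:])"
  have "g_mat n k p = map_mat to_fract Q"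
    by (rule eq_matI)
       (auto simp: g_mat_def g_entry_def g_coeff_def Q_def const_rf_def lambda_rf_def case_prod_unfold
         simp del: mult_pCons_left mult_pCons_right)
  moreover have "g_value n k p x = map_mat (\<lambda>q. poly q x) Q"
    by (rule eq_matI) (auto simp: g_value_def Q_def)
  moreover have "Q \<in> carrier_mat n n" by (simp add: Q_def)
  ultimately show ?thesis unfolding polynomial_value_def by blast
qed

text \<open>The factor \<open>y j\<close> collects the denominator and, for \<open>k \<le> j\<close>, the factor \<open>t\<close> of the entries on and below the
  diagonal.\<close>

lemma g_value_interval_matrix:
  assumes k: "1 \<le> k" "k \<le> n" and A: "spanning_matrix n k N A"
    and pos: "positive_rows (\<lambda>i c. A $$ (i, c)) n k" and t: "0 < t"
  obtains y where "\<And>j. j < n \<Longrightarrow> 0 < y j"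
    "\<And>i j. i < n \<Longrightarrow> j < n \<Longrightarrow>
      g_value n k (N, t) x $$ (i, j) = interval_matrix (\<lambda>i c. A $$ (i, c)) n k ((-1) ^ (k - 1) * x / t) i j * y j"
proof -
  define V where "V = (\<lambda>i c. A $$ (i, c))"
  have n: "0 < n" using k by simp
  have Ac: "A \<in> carrier_mat n k" using A by (simp add: spanning_matrix_def)
  obtain c where c: "c \<noteq> 0" "\<And>I. plucker n k N I = c * row_minor n k A I"
    using plucker_unique[OF n A] by blast
  define d where "d j = row_minor n k A {int j + 1 - int k..int j + 1 - 1}" for j :: nat
  have d: "0 < d j" for j
  proof -
    define S where "S = reduced_rows n {int j + 1 - int k..int j + 1 - 1}"
    have "card S = k" unfolding S_def by (rule card_reduced_rows_interval[OF k(2)])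
    moreover have "S \<subseteq> {..<n}" using reduced_rows_less[OF n] by (auto simp: S_def)
    ultimately have "index_seq k n (pick S)" "reduced_rows n {int j + 1 - int k..int j + 1 - 1} = pick S ` {..<k}"
      using index_seq_pick[of S n k] by (auto simp: S_def)
    then show ?thesis unfolding d_def
      using row_minor_index_seq[OF Ac] pos by (simp add: positive_rows_def)
  qed
  define y where "y j = (if j < k then 1 else t) / d j" for j
  have "0 < y j" for j unfolding y_def
    by (rule complex_pos_divide) (use t d in \<open>auto simp: less_complex_def[of 0 1]\<close>)
  moreover have "g_value n k (N, t) x $$ (i, j) = interval_matrix V n k ((-1) ^ (k - 1) * x / t) i j * y j"
    if ij: "i < n" "j < n" for i j
  proof -
    have e: "(-1) ^ (k - 1) * ((-1) ^ (k - 1) * z) = (z::complex)" for z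
      by (simp add: mult.assoc[symmetric] flip: power_mult_distrib)
    have "g_value n k (N, t) x $$ (i, j) = (if j < k then 1 else if j \<le> i then t else x) *
      (row_minor n k A ({int j + 1 - int k + 1..int j + 1 - 1} \<union> {int i + 1}) / d j)"
      using ij c(1) by (simp add: g_value_def c(2) d_def)
    also have "\<dots> = (if j < k then 1 else if j \<le> i then t else x) *
      ((if k \<le> j \<and> i < j then (-1) ^ (k - 1) else 1) * interval_minor V n k i j / d j)"
      by (simp only: row_minor_interval[OF Ac k ij] V_def)
    also have "\<dots> = interval_matrix V n k ((-1) ^ (k - 1) * x / t) i j * y j"
      using t by (auto simp: interval_matrix_def y_def)
    finally show ?thesis .
  qed
  ultimately show ?thesis using that unfolding V_def by blast
qed

text \<open>Here \<open>\<nu> = (-1)\<^sup>k\<^sup>-\<^sup>1 x / t\<close>, so \<open>(-1)\<^sup>k\<^sup>+\<^sup>r \<nu>\<close> and \<open>(-1)\<^sup>r\<^sup>-\<^sup>1 x\<close> have the same sign, and \<open>\<nu> = 1\<close> means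
  \<open>x = (-1)\<^sup>k\<^sup>-\<^sup>1 t\<close>, where \<open>g(N|t)\<close> has rank \<open>k\<close>.\<close>

lemma nonneg_minors_mat_g_value:
  assumes k: "1 \<le> k" "k \<le> n" and r: "1 \<le> r" "r \<le> n" and X: "p \<in> XX n k" "positive_point n k p"
    and x: "0 < (-1) ^ (r - 1) * x" and cond: "r \<le> k \<or> (-1) ^ (k - 1) * x \<noteq> snd p"
  shows "nonneg_minors_mat n r (g_value n k p x)"
proof -
  obtain N t where p: "p = (N, t)" by (cases p)
  have t: "0 < t" using X by (simp add: positive_point_def p)
  obtain A where A: "spanning_matrix n k N A" "positive_rows (\<lambda>i c. A $$ (i, c)) n k"
    using positive_spanning_matrix[OF k] X p by blast
  define V where "V = (\<lambda>i c. A $$ (i, c))"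
  define \<nu> where "\<nu> = (-1) ^ (k - 1) * x / t"
  obtain y where y: "\<And>j. j < n \<Longrightarrow> 0 < y j"
    "\<And>i j. i < n \<Longrightarrow> j < n \<Longrightarrow> g_value n k (N, t) x $$ (i, j) = interval_matrix V n k \<nu> i j * y j"
    unfolding V_def \<nu>_def using g_value_interval_matrix[OF k A t, of x] by blast
  have "(-1) ^ (k + r) * \<nu> = ((-1) ^ (r - 1) * x) / t"
  proof -
    have "(-1) ^ (k + r) * (-1) ^ (k - 1) = ((-1) ^ (r - 1) :: complex)"
    proof -
      have "(k + r) + (k - 1) = (r - 1) + 2 * k" using k r by simp
      then show ?thesis by (simp only: power_add[symmetric]) (simp add: power_add power_mult)
    qed
    then show ?thesis by (simp add: \<nu>_def mult.assoc[symmetric])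
  qed
  then have nu: "0 < (-1) ^ (k + r) * \<nu>" using x t by (simp add: complex_pos_divide)
  have good: "nonneg_minors_in_rows V n k r \<nu> f" if "index_seq r n f" for f
    using interval_matrix_minors[OF _ k r(1) nu that] A(2) by (simp add: V_def)
  have eq: "minor (\<lambda>i j. g_value n k p x $$ (i, j)) r f h = minor (interval_matrix V n k \<nu>) r f h * (\<Prod>b<r. y (h b))"
    if f: "index_seq r n f" and h: "index_seq r n h" for f h
  proof -
    have "minor (\<lambda>i j. g_value n k p x $$ (i, j)) r f h = minor (\<lambda>i j. 1 * interval_matrix V n k \<nu> i j * y j) r f h"
      by (rule minor_cong) (simp add: p y(2) index_seqD(2)[OF f] index_seqD(2)[OF h])
    then show ?thesis by (simp only: minor_scale) simp
  qed
  have yp: "0 < (\<Prod>b<r. y (h b))" if "index_seq r n h" for h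
    using index_seqD(2)[OF that] by (intro complex_pos_prod y(1)) auto
  have id: "index_seq r n id" using r by (intro index_seq_id)
  have "r \<le> k \<or> \<nu> \<noteq> 1" using cond t by (auto simp: \<nu>_def p)
  then have "0 < minor (interval_matrix V n k \<nu>) r id id" using good[OF id] by (simp add: nonneg_minors_in_rows_def)
  then have "0 < minor (\<lambda>i j. g_value n k p x $$ (i, j)) r id id"
    unfolding eq[OF id id] by (rule complex_pos_mult[OF _ yp[OF id]])
  moreover have "0 \<le> minor (\<lambda>i j. g_value n k p x $$ (i, j)) r f h"
    if "index_seq r n f" "index_seq r n h" for f h
    unfolding eq[OF that]
    using good[OF that(1)] that(2) less_imp_le[OF yp[OF that(2)]]
    by (simp add: nonneg_minors_in_rows_def mult_nonneg_nonneg)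
  ultimately show ?thesis by (simp add: nonneg_minors_mat_def g_value_def)
qed

text \<open>At its own value of \<open>\<lambda>\<close> the matrix has \<open>\<nu> = 1\<close>, and every column is a combination of the columns of \<open>A\<close>.\<close>

lemma g_value_factor:
  assumes k: "1 \<le> k" "k \<le> n" and A: "spanning_matrix n k N A"
    and pos: "positive_rows (\<lambda>i c. A $$ (i, c)) n k" and t: "0 < t"
  obtains \<Phi> where "\<Phi> \<in> carrier_mat k n" "g_value n k (N, t) ((-1) ^ (k - 1) * t) = A * \<Phi>"
proof -
  have Ac: "A \<in> carrier_mat n k" using A by (simp add: spanning_matrix_def)
  have one: "(-1) ^ (k - 1) * ((-1) ^ (k - 1) * t) / t = 1"
    using t by (simp add: mult.assoc[symmetric] flip: power_mult_distrib)
  have "interval_matrix V n k 1 i j = interval_minor V n k i j" for V i j by (simp add: interval_matrix_def)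
  then obtain y where y: "\<And>i j. i < n \<Longrightarrow> j < n \<Longrightarrow>
    g_value n k (N, t) ((-1) ^ (k - 1) * t) $$ (i, j) = interval_minor (\<lambda>i c. A $$ (i, c)) n k i j * y j"
    using g_value_interval_matrix[OF k A pos t, of "(-1) ^ (k - 1) * t", unfolded one] by metis
  have "\<forall>j. \<exists>\<gamma>. \<forall>i. interval_minor (\<lambda>i c. A $$ (i, c)) n k i j = (\<Sum>c<k. A $$ (i, c) * \<gamma> c)"
    using interval_minor_linear[OF k(1)] by metis
  then obtain \<gamma> where \<gamma>: "\<And>i j. interval_minor (\<lambda>i c. A $$ (i, c)) n k i j = (\<Sum>c<k. A $$ (i, c) * \<gamma> j c)"
    by metis
  define \<Phi> where "\<Phi> = mat k n (\<lambda>(c, j). \<gamma> j c * y j)"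
  have "g_value n k (N, t) ((-1) ^ (k - 1) * t) = A * \<Phi>"
  proof (rule eq_matI)
    fix i j assume "i < dim_row (A * \<Phi>)" "j < dim_col (A * \<Phi>)"
    then have ij: "i < n" "j < n" using Ac by (auto simp: \<Phi>_def)
    then show "g_value n k (N, t) ((-1) ^ (k - 1) * t) $$ (i, j) = (A * \<Phi>) $$ (i, j)"
      using Ac unfolding y[OF ij] \<gamma>
      by (simp add: \<Phi>_def scalar_prod_def atLeast0LessThan sum_distrib_left sum_distrib_right mult_ac)
  qed (use Ac in \<open>auto simp: \<Phi>_def g_value_def\<close>)
  then show ?thesis using that[of \<Phi>] by (simp add: \<Phi>_def)
qed

lemma g_product_value:
  assumes r: "1 \<le> r" "r \<le> n" and x: "0 < (-1) ^ (r - 1) * x"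
    and "list_all2 (\<lambda>k p. 1 \<le> k \<and> k \<le> n \<and> p \<in> XX n k \<and> positive_point n k p \<and>
      (-1) ^ (k - 1) * x \<noteq> snd p) ks ps"
  shows "\<exists>E. polynomial_value n x (g_product n ks ps) E \<and> nonneg_minors_mat n r E"
  using assms(4)
proof (induction rule: list_all2_induct)
  case Nil
  then show ?case using polynomial_value_one nonneg_minors_mat_one[OF r(2)] by (auto simp: g_product_def)
next
  case (Cons k ks p ps)
  then obtain E where E: "polynomial_value n x (g_product n ks ps) E" "nonneg_minors_mat n r E" by blast
  have "g_product n (k # ks) (p # ps) = g_mat n k p * g_product n ks ps" by (simp add: g_product_def)
  then show ?case
    using polynomial_value_mult[OF polynomial_value_g_mat E(1)]
      nonneg_minors_mat_mult[OF nonneg_minors_mat_g_value E(2) r(2)] r x Cons.hyps(1) by metis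
qed

theorem lemma5p7:
  fixes n d :: nat and ks :: "nat list" and ps :: "point list"
  assumes "n \<ge> 2" and "d \<ge> 1"
    and "length ks = d" and "set ks \<subseteq> {1..n - 1}"
    and "ps \<in> UU n ks"
  shows "pi_proj n (ks ! 0) (snd (ps ! 0)) (g_product n ks ps) = Some (ps ! 0) \<and>
         column_span n (first_cols (ks ! 0)
           (eval_mat ((-1) ^ (ks ! 0 - 1) * snd (ps ! 0)) (g_product n ks ps))) = fst (ps ! 0)"
proof -
  have len: "length ps = length ks"
    and pts: "\<And>i. i < length ks \<Longrightarrow> ps ! i \<in> XX n (ks ! i) \<and> positive_point n (ks ! i) (ps ! i)"
    and dist: "distinct (map snd ps)"
    using assms(5) by (auto simp: UU_def)
  obtain k ks' where ks: "ks = k # ks'" using assms(2,3) by (cases ks) auto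
  obtain p ps' where ps: "ps = p # ps'" using len ks by (cases ps) auto
  obtain N t where p: "p = (N, t)" by (cases p)
  have k: "1 \<le> k" "k \<le> n" using assms(1,4) ks by auto
  have X: "(N, t) \<in> XX n k" "positive_point n k (N, t)" using pts[of 0] by (auto simp: ks ps p)
  have t: "0 < t" using X by (simp add: positive_point_def)
  define x where "x = (-1) ^ (k - 1) * t"
  have xt: "(-1) ^ (k - 1) * x = t" by (simp add: x_def mult.assoc[symmetric] flip: power_mult_distrib)
  then have x: "0 < (-1) ^ (k - 1) * x" using t by simp
  have "list_all2 (\<lambda>k p. 1 \<le> k \<and> k \<le> n \<and> p \<in> XX n k \<and> positive_point n k p \<and>
      (-1) ^ (k - 1) * x \<noteq> snd p) ks' ps'"
    unfolding list_all2_conv_all_nth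
  proof (intro conjI allI impI)
    show "length ks' = length ps'" using len by (simp add: ks ps)
    fix i assume i: "i < length ks'"
    have "ks' ! i \<in> set ks" using i by (auto simp: ks)
    then show "1 \<le> ks' ! i" "ks' ! i \<le> n" using assms(1,4) by fastforce+
    have *: "ps' ! i \<in> XX n (ks' ! i) \<and> positive_point n (ks' ! i) (ps' ! i)"
      using pts[of "Suc i"] i by (simp add: ks ps)
    then show "ps' ! i \<in> XX n (ks' ! i)" "positive_point n (ks' ! i) (ps' ! i)" by auto
    have pos: "0 < snd (ps' ! i)" using * by (simp add: positive_point_def case_prod_unfold)
    have ne: "snd (ps' ! i) \<noteq> t" using dist i len by (force simp: ks ps p)
    \<comment> \<open>Equal parities would force \<open>t\<^sub>i = t\<^sub>1\<close>, different ones \<open>t\<^sub>i = - t\<^sub>1\<close>.\<close>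
    show "(-1) ^ (ks' ! i - 1) * x \<noteq> snd (ps' ! i)"
    proof
      assume eq: "(-1) ^ (ks' ! i - 1) * x = snd (ps' ! i)"
      have "((-1) ^ (ks' ! i - 1) * (-1) ^ (k - 1) :: complex) = 1 \<or>
        ((-1) ^ (ks' ! i - 1) * (-1) ^ (k - 1) :: complex) = - 1"
        by (cases "even (ks' ! i - 1)"; cases "even (k - 1)") auto
      then have "snd (ps' ! i) = t \<or> snd (ps' ! i) = - t"
        using eq by (auto simp: x_def mult.assoc[symmetric])
      then show False using ne t pos by (auto simp: less_complex_def)
    qed
  qed
  then obtain E where E: "polynomial_value n x (g_product n ks' ps') E" "nonneg_minors_mat n k E"
    using g_product_value[OF k x] by blast
  define G where "G = g_value n k p x"
  have prod: "g_product n ks ps = g_mat n k p * g_product n ks' ps'" by (simp add: g_product_def ks ps)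
  have val: "polynomial_value n x (g_product n ks ps) (G * E)"
    unfolding prod G_def by (rule polynomial_value_mult[OF polynomial_value_g_mat E(1)])
  have "nonneg_minors_mat n k G"
    unfolding G_def using X k x by (intro nonneg_minors_mat_g_value) (auto simp: p)
  then have GE: "nonneg_minors_mat n k (G * E)" by (rule nonneg_minors_mat_mult[OF _ E(2) k(2)])
  obtain A where A: "spanning_matrix n k N A" "positive_rows (\<lambda>i c. A $$ (i, c)) n k"
    using positive_spanning_matrix[OF k X] by blast
  have Ac: "A \<in> carrier_mat n k" using A by (simp add: spanning_matrix_def)
  have Ec: "E \<in> carrier_mat n n" using E(2) by (simp add: nonneg_minors_mat_def)
  obtain \<Phi> where \<Phi>: "\<Phi> \<in> carrier_mat k n" "G = A * \<Phi>"
    using g_value_factor[OF k A t] unfolding G_def p x_def by blast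
  define M where "M = first_cols k (\<Phi> * E)"
  have M: "M \<in> carrier_mat k k" using \<Phi> by (simp add: M_def first_cols_def)
  have "G * E = A * (\<Phi> * E)" unfolding \<Phi>(2) by (rule assoc_mult_mat[OF Ac \<Phi>(1) Ec])
  moreover have "first_cols k (A * (\<Phi> * E)) = A * M"
    using Ac \<Phi> Ec k by (intro eq_matI) (auto simp: first_cols_def M_def scalar_prod_def)
  ultimately have cols: "first_cols k (G * E) = A * M" by simp
  have "det M \<noteq> 0"
  proof
    assume "det M = 0"
    then have "row_minor n k (A * M) {1..int k} = 0"
      using row_minor_mult[of n A k M] k Ac M by simp
    moreover have "reduced_rows n {1..int k} = id ` {..<k}"
    proof -
      have "{1..int k} = (\<lambda>a. int a + 1) ` {..<k}"
      proof
        show "{1..int k} \<subseteq> (\<lambda>a. int a + 1) ` {..<k}"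
        proof
          fix m assume "m \<in> {1..int k}"
          then show "m \<in> (\<lambda>a. int a + 1) ` {..<k}" by (intro image_eqI[of _ _ "nat (m - 1)"]) auto
        qed
      qed auto
      then have "reduced_rows n {1..int k} = (\<lambda>a. nat (int a mod int n)) ` {..<k}"
        by (simp add: reduced_rows_def image_image)
      also have "\<dots> = id ` {..<k}" by (rule image_cong) (use k in auto)
      finally show ?thesis .
    qed
    then have "row_minor n k (A * M) {1..int k} = minor (\<lambda>i c. (A * M) $$ (i, c)) k id id"
      using Ac M by (intro row_minor_index_seq index_seq_id k(2)) auto
    moreover have "minor (\<lambda>i c. (A * M) $$ (i, c)) k id id = minor (\<lambda>i c. (G * E) $$ (i, c)) k id id"
      unfolding cols[symmetric]
      using k GE by (intro minor_cong) (auto simp: first_cols_def nonneg_minors_mat_def)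
    ultimately show False using GE by (simp add: nonneg_minors_mat_def)
  qed
  note span = column_span_mult_invertible[OF Ac M this]
  have "column_span n (first_cols k (eval_mat x (g_product n ks ps))) = N"
    "vec_space.rank n (first_cols k (eval_mat x (g_product n ks ps))) = k"
    unfolding polynomial_value_eval(2)[OF val] cols span using A by (auto simp: spanning_matrix_def)
  then show ?thesis
    using polynomial_value_eval(1,3)[OF val] t
    by (auto simp: pi_proj_def Let_def ks ps p x_def)
qed

end
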